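(* Let $\mathcal{M}$ be an infinite structure and $(I,<)$ any linear order. Then there is a proper elementary extension $\mathcal{M}^\ast$ of $\mathcal{M}$ and a group embedding $\alpha\mapsto\widehat{\alpha}$ from $\mathrm{Aut}(I,<)$ into $\mathrm{Aut}(\mathcal{M}^\ast)$ such that $\widehat{\alpha}$ moves every element of $M^\ast\setminus M$ and fixes every element of $M$ whenever $\alpha$ is fixed point free.
   Context: $\mathrm{Aut}(\mathcal{S})$ denotes the automorphism group of a structure $\mathcal{S}$; $\mathrm{Aut}(I,<)$ is the group of order-automorphisms of $(I,<)$. An automorphism $\alpha$ of $(I,<)$ is fixed point free if $\alpha(i)\neq i$ for all $i\in I$.
   Formalization: The linear order (I,<) is assumed nonempty; for empty I the identity is vacuously fixed point free, yet its image is the identity and cannot move the elements of the nonempty set M*\M, so the claim fails there. *)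

theory Defs
  imports "HOL-Algebra.Bij"
begin

section \<open>First-order structures\<close>

text \<open>
  A language is given by sets of function and relation symbols with their arities; constant symbols
  are function symbols of arity 0.  Equality is a logical symbol.
\<close>

record ('f, 'r) language =
  fun_syms :: "'f set"
  fun_arity :: "'f \<Rightarrow> nat"
  rel_syms :: "'r set"
  rel_arity :: "'r \<Rightarrow> nat"

record ('f, 'r, 'a) fo_struct =
  universe :: "'a set"
  fun_int :: "'f \<Rightarrow> 'a list \<Rightarrow> 'a"
  rel_int :: "'r \<Rightarrow> 'a list \<Rightarrow> bool"

definition tuples :: "'a set \<Rightarrow> nat \<Rightarrow> 'a list set" where
  "tuples A n = {xs. set xs \<subseteq> A \<and> length xs = n}"

definition is_struct :: "('f, 'r) language \<Rightarrow> ('f, 'r, 'a) fo_struct \<Rightarrow> bool" where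
  "is_struct L M \<longleftrightarrow> universe M \<noteq> {} \<and>
     (\<forall>f\<in>fun_syms L. \<forall>xs\<in>tuples (universe M) (fun_arity L f). fun_int M f xs \<in> universe M)"

datatype 'f trm = Var nat | Fn 'f "'f trm list"

datatype ('f, 'r) fm =
    Eq "'f trm" "'f trm"
  | Rel 'r "'f trm list"
  | Neg "('f, 'r) fm"
  | Conj "('f, 'r) fm" "('f, 'r) fm"
  | Ex nat "('f, 'r) fm"

fun is_trm :: "('f, 'r) language \<Rightarrow> 'f trm \<Rightarrow> bool" where
  "is_trm L (Var n) \<longleftrightarrow> True"
| "is_trm L (Fn f ts) \<longleftrightarrow>
     f \<in> fun_syms L \<and> length ts = fun_arity L f \<and> (\<forall>t\<in>set ts. is_trm L t)"

fun is_fm :: "('f, 'r) language \<Rightarrow> ('f, 'r) fm \<Rightarrow> bool" where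
  "is_fm L (Eq s t) \<longleftrightarrow> is_trm L s \<and> is_trm L t"
| "is_fm L (Rel r ts) \<longleftrightarrow>
     r \<in> rel_syms L \<and> length ts = rel_arity L r \<and> (\<forall>t\<in>set ts. is_trm L t)"
| "is_fm L (Neg p) \<longleftrightarrow> is_fm L p"
| "is_fm L (Conj p q) \<longleftrightarrow> is_fm L p \<and> is_fm L q"
| "is_fm L (Ex n p) \<longleftrightarrow> is_fm L p"

fun eval :: "('f, 'r, 'a) fo_struct \<Rightarrow> (nat \<Rightarrow> 'a) \<Rightarrow> 'f trm \<Rightarrow> 'a" where
  "eval M e (Var n) = e n"
| "eval M e (Fn f ts) = fun_int M f (map (eval M e) ts)"

fun sat :: "('f, 'r, 'a) fo_struct \<Rightarrow> (nat \<Rightarrow> 'a) \<Rightarrow> ('f, 'r) fm \<Rightarrow> bool" where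
  "sat M e (Eq s t) \<longleftrightarrow> eval M e s = eval M e t"
| "sat M e (Rel r ts) \<longleftrightarrow> rel_int M r (map (eval M e) ts)"
| "sat M e (Neg p) \<longleftrightarrow> \<not> sat M e p"
| "sat M e (Conj p q) \<longleftrightarrow> sat M e p \<and> sat M e q"
| "sat M e (Ex n p) \<longleftrightarrow> (\<exists>a\<in>universe M. sat M (e(n := a)) p)"


section \<open>Elementary extensions\<close>

definition substruct ::
    "('f, 'r) language \<Rightarrow> ('f, 'r, 'a) fo_struct \<Rightarrow> ('f, 'r, 'a) fo_struct \<Rightarrow> bool" where
  "substruct L M N \<longleftrightarrow> is_struct L M \<and> is_struct L N \<and> universe M \<subseteq> universe N \<and>
     (\<forall>f\<in>fun_syms L. \<forall>xs\<in>tuples (universe M) (fun_arity L f). fun_int M f xs = fun_int N f xs) \<and>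
     (\<forall>r\<in>rel_syms L. \<forall>xs\<in>tuples (universe M) (rel_arity L r). rel_int M r xs \<longleftrightarrow> rel_int N r xs)"

definition elem_extension ::
    "('f, 'r) language \<Rightarrow> ('f, 'r, 'a) fo_struct \<Rightarrow> ('f, 'r, 'a) fo_struct \<Rightarrow> bool" where
  "elem_extension L M N \<longleftrightarrow> substruct L M N \<and>
     (\<forall>p e. is_fm L p \<and> range e \<subseteq> universe M \<longrightarrow> (sat M e p \<longleftrightarrow> sat N e p))"

definition proper_elem_extension ::
    "('f, 'r) language \<Rightarrow> ('f, 'r, 'a) fo_struct \<Rightarrow> ('f, 'r, 'a) fo_struct \<Rightarrow> bool" where
  "proper_elem_extension L M N \<longleftrightarrow> elem_extension L M N \<and> universe M \<noteq> universe N"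

text \<open>
  The copy of a structure obtained by renaming its elements along an injection \<open>j\<close>.  It is used with
  \<open>j = Inl\<close> only, to view a structure over the type \<open>'m\<close> as a structure over a larger type in which
  there is room for a proper extension.
\<close>

definition struct_copy ::
    "('a \<Rightarrow> 'b) \<Rightarrow> ('f, 'r, 'a) fo_struct \<Rightarrow> ('f, 'r, 'b) fo_struct" where
  "struct_copy j M =
     \<lparr>universe = j ` universe M,
      fun_int = \<lambda>f ys. j (fun_int M f (map (inv_into (universe M) j) ys)),
      rel_int = \<lambda>r ys. rel_int M r (map (inv_into (universe M) j) ys)\<rparr>"

lemma struct_copy_simps [simp]:
  "universe (struct_copy j M) = j ` universe M"
  "fun_int (struct_copy j M) f ys = j (fun_int M f (map (inv_into (universe M) j) ys))"
  "rel_int (struct_copy j M) r ys = rel_int M r (map (inv_into (universe M) j) ys)"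
  by (simp_all add: struct_copy_def)

lemma eval_struct_copy:
  assumes M: "is_struct L M" and j: "inj_on j (universe M)"
    and t: "is_trm L t" and e: "range e \<subseteq> universe M"
  shows "eval M e t \<in> universe M \<and> eval (struct_copy j M) (\<lambda>k. j (e k)) t = j (eval M e t)"
  using t
proof (induction t)
  case (Var n)
  then show ?case using e by auto
next
  case (Fn f ts)
  then have IH: "\<And>t. t \<in> set ts \<Longrightarrow> eval M e t \<in> universe M"
      "\<And>t. t \<in> set ts \<Longrightarrow> eval (struct_copy j M) (\<lambda>k. j (e k)) t = j (eval M e t)"
    by auto
  have "map (eval M e) ts \<in> tuples (universe M) (fun_arity L f)"
    using Fn.prems IH by (auto simp: tuples_def)
  moreover have "map (inv_into (universe M) j) (map (eval (struct_copy j M) (\<lambda>k. j (e k))) ts)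
      = map (eval M e) ts"
    using IH j by simp
  ultimately show ?case
    using Fn.prems M by (simp add: is_struct_def del: map_map)
qed

lemma sat_struct_copy:
  assumes M: "is_struct L M" and j: "inj_on j (universe M)"
    and p: "is_fm L p" and e: "range e \<subseteq> universe M"
  shows "sat (struct_copy j M) (\<lambda>k. j (e k)) p \<longleftrightarrow> sat M e p"
  using p e
proof (induction p arbitrary: e)
  case (Eq s t)
  then show ?case
    using eval_struct_copy[OF M j, of s e] eval_struct_copy[OF M j, of t e] j
    by (auto dest: inj_onD)
next
  case (Rel r ts)
  then have "map (inv_into (universe M) j) (map (eval (struct_copy j M) (\<lambda>k. j (e k))) ts)
      = map (eval M e) ts"
    using eval_struct_copy[OF M j] j by simp
  then show ?case by (simp del: map_map)
next
  case (Ex n p)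
  have "sat (struct_copy j M) ((\<lambda>k. j (e k))(n := j a)) p \<longleftrightarrow> sat M (e(n := a)) p"
    if "a \<in> universe M" for a
  proof -
    have "range (e(n := a)) \<subseteq> universe M" using Ex.prems that by auto
    moreover have "(\<lambda>k. j (e k))(n := j a) = (\<lambda>k. j ((e(n := a)) k))" by auto
    ultimately show ?thesis using Ex.IH[of "e(n := a)"] Ex.prems(1) by (simp del: fun_upd_apply)
  qed
  then show ?case by simp
qed auto


section \<open>Automorphism groups\<close>

definition automorphisms :: "('f, 'r) language \<Rightarrow> ('f, 'r, 'a) fo_struct \<Rightarrow> ('a \<Rightarrow> 'a) set" where
  "automorphisms L M = {g \<in> Bij (universe M).
     (\<forall>f\<in>fun_syms L. \<forall>xs\<in>tuples (universe M) (fun_arity L f).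
        g (fun_int M f xs) = fun_int M f (map g xs)) \<and>
     (\<forall>r\<in>rel_syms L. \<forall>xs\<in>tuples (universe M) (rel_arity L r).
        rel_int M r xs \<longleftrightarrow> rel_int M r (map g xs))}"

definition Aut :: "('f, 'r) language \<Rightarrow> ('f, 'r, 'a) fo_struct \<Rightarrow> ('a \<Rightarrow> 'a) monoid" where
  "Aut L M = BijGroup (universe M) \<lparr>carrier := automorphisms L M\<rparr>"

definition order_automorphisms :: "'i set \<Rightarrow> 'i rel \<Rightarrow> ('i \<Rightarrow> 'i) set" where
  "order_automorphisms I r =
     {g \<in> Bij I. \<forall>i\<in>I. \<forall>j\<in>I. (i, j) \<in> r \<longleftrightarrow> (g i, g j) \<in> r}"

definition Aut_order :: "'i set \<Rightarrow> 'i rel \<Rightarrow> ('i \<Rightarrow> 'i) monoid" where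
  "Aut_order I r = BijGroup I \<lparr>carrier := order_automorphisms I r\<rparr>"

definition fixed_point_free :: "'i set \<Rightarrow> ('i \<Rightarrow> 'i) \<Rightarrow> bool" where
  "fixed_point_free I g \<longleftrightarrow> (\<forall>i\<in>I. g i \<noteq> i)"

text \<open>
  HOL cannot quantify existentially over types, so an extension of a structure over \<open>'m\<close> has to be
  sought over a specific type that is large enough.  The second summand below has room for the
  elements of an ultrapower of the structure over an ultrafilter on the natural numbers, iterated
  along a linear order on a subset of \<open>'i\<close>.
\<close>

type_synonym ('i, 'm) ambient = "'m + (('i \<Rightarrow> nat) \<Rightarrow> 'm)"

lemma group_Bij_subset:
  assumes sub: "A \<subseteq> Bij S" and one: "(\<lambda>x\<in>S. x) \<in> A"
    and comp: "\<And>g h. g \<in> A \<Longrightarrow> h \<in> A \<Longrightarrow> compose S g h \<in> A"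
    and inv: "\<And>g. g \<in> A \<Longrightarrow> (\<lambda>x\<in>S. inv_into S g x) \<in> A"
  shows "group (BijGroup S \<lparr>carrier := A\<rparr>)"
proof (rule subgroup.subgroup_is_group[OF _ group_BijGroup], rule subgroup.intro)
  show "A \<subseteq> carrier (BijGroup S)" using sub by (simp add: BijGroup_def)
  show "x \<otimes>\<^bsub>BijGroup S\<^esub> y \<in> A" if "x \<in> A" "y \<in> A" for x y
    using that sub comp by (auto simp: BijGroup_def subset_iff)
  show "\<one>\<^bsub>BijGroup S\<^esub> \<in> A" using one by (simp add: BijGroup_def)
  show "inv\<^bsub>BijGroup S\<^esub> x \<in> A" if "x \<in> A" for x
    using that sub inv by (simp add: inv_BijGroup subset_iff)
qed

lemma group_Aut_order: "group (Aut_order I r)"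
  unfolding Aut_order_def
proof (rule group_Bij_subset)
  show "order_automorphisms I r \<subseteq> Bij I" by (auto simp: order_automorphisms_def)
  show "(\<lambda>x\<in>I. x) \<in> order_automorphisms I r"
    by (auto simp: order_automorphisms_def id_Bij)
  show "compose I g h \<in> order_automorphisms I r"
    if "g \<in> order_automorphisms I r" "h \<in> order_automorphisms I r" for g h
  proof -
    have "h \<in> I \<rightarrow> I" using that by (auto simp: order_automorphisms_def dest: Bij_imp_funcset)
    then show ?thesis
      using that by (auto simp: order_automorphisms_def compose_Bij compose_eq Pi_iff)
  qed
  show "(\<lambda>x\<in>I. inv_into I g x) \<in> order_automorphisms I r"
    if g: "g \<in> order_automorphisms I r" for g
  proof -
    have B: "g \<in> Bij I" using g by (simp add: order_automorphisms_def)
    then have s: "g ` I = I" by (simp add: Bij_def bij_betw_def)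
    have "inv_into I g x \<in> I" "g (inv_into I g x) = x" if "x \<in> I" for x
      using that s by (auto intro: inv_into_into f_inv_into_f)
    then show ?thesis
      using g restrict_inv_into_Bij[OF B] by (auto simp: order_automorphisms_def)
  qed
qed

lemma group_Aut:
  assumes M: "is_struct L M"
  shows "group (Aut L M)"
  unfolding Aut_def
proof (rule group_Bij_subset)
  let ?U = "universe M"
  show "automorphisms L M \<subseteq> Bij ?U" by (auto simp: automorphisms_def)
  have clos: "fun_int M f xs \<in> ?U" if "f \<in> fun_syms L" "xs \<in> tuples ?U (fun_arity L f)" for f xs
    using M that by (simp add: is_struct_def)
  have id: "map (\<lambda>x\<in>?U. x) xs = xs" if "xs \<in> tuples ?U n" for xs n
    using that by (auto simp: tuples_def subset_iff intro: map_idI)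
  show "(\<lambda>x\<in>?U. x) \<in> automorphisms L M"
    using clos id by (auto simp: automorphisms_def id_Bij)
  show "compose ?U g h \<in> automorphisms L M"
    if g: "g \<in> automorphisms L M" and h: "h \<in> automorphisms L M" for g h
  proof -
    have B: "g \<in> Bij ?U" "h \<in> Bij ?U" using g h by (auto simp: automorphisms_def)
    then have hU: "h x \<in> ?U" if "x \<in> ?U" for x using that Bij_imp_funcset by blast
    have m: "map (compose ?U g h) xs = map g (map h xs)" "map h xs \<in> tuples ?U n"
      if "xs \<in> tuples ?U n" for xs n
      using that hU by (auto simp: tuples_def compose_eq subset_iff)
    show ?thesis
      using g h clos m(2) compose_Bij[OF B]
      by (auto simp: automorphisms_def m(1) compose_eq simp del: map_map)
  qed
  show "(\<lambda>x\<in>?U. inv_into ?U g x) \<in> automorphisms L M"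
    if g: "g \<in> automorphisms L M" for g
  proof -
    let ?k = "\<lambda>x\<in>?U. inv_into ?U g x"
    have B: "g \<in> Bij ?U" using g by (simp add: automorphisms_def)
    then have s: "g ` ?U = ?U" and i: "inj_on g ?U" by (auto simp: Bij_def bij_betw_def)
    have k: "?k x \<in> ?U" "g (?k x) = x" if "x \<in> ?U" for x
      using that s by (auto intro: inv_into_into f_inv_into_f)
    have m: "map ?k xs \<in> tuples ?U n" "map g (map ?k xs) = xs" if "xs \<in> tuples ?U n" for xs n
    proof -
      show "map ?k xs \<in> tuples ?U n" using that k(1) by (auto simp: tuples_def)
      have "\<forall>x\<in>set xs. g (?k x) = x" using that k(2) by (auto simp: tuples_def)
      then show "map g (map ?k xs) = xs" by (simp only: map_map) (simp add: map_idI)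
    qed
    have "?k (fun_int M f xs) = fun_int M f (map ?k xs)"
      if f: "f \<in> fun_syms L" and xs: "xs \<in> tuples ?U (fun_arity L f)" for f xs
    proof (rule inj_onD[OF i])
      have "g (fun_int M f (map ?k xs)) = fun_int M f (map g (map ?k xs))"
        using g f m(1)[OF xs] unfolding automorphisms_def by blast
      then show "g (?k (fun_int M f xs)) = g (fun_int M f (map ?k xs))"
        using k(2)[OF clos[OF f xs]] m(2)[OF xs] by simp
    qed (use k(1) clos f xs m(1) in blast)+
    moreover have "rel_int M r xs \<longleftrightarrow> rel_int M r (map ?k xs)"
      if r: "r \<in> rel_syms L" and xs: "xs \<in> tuples ?U (rel_arity L r)" for r xs
    proof -
      have "rel_int M r (map ?k xs) \<longleftrightarrow> rel_int M r (map g (map ?k xs))"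
        using g r m(1)[OF xs] unfolding automorphisms_def by blast
      then show ?thesis using m(2)[OF xs] by simp
    qed
    ultimately show ?thesis
      using restrict_inv_into_Bij[OF B] unfolding automorphisms_def by blast
  qed
qed

end

theory Submission
  imports Defs
begin

text \<open>
  Iterate the ultrapower of \<open>M\<close> by a nonprincipal ultrafilter on the naturals along \<open>I\<close>: the
  elements are functions on \<open>I \<Rightarrow> nat\<close> that depend on finitely many coordinates, two of them being
  identified if they agree almost everywhere, where ``almost everywhere'' quantifies over the
  relevant coordinates one by one in the order of \<open>I\<close>. This is a limit ultrapower, so the theorem
  of Los applies, and an automorphism of \<open>I\<close> acts by permuting coordinates. If two functions
  agree almost everywhere then they agree almost everywhere with a function that depends only on
  their common coordinates, so each class has a least support. The least support of a class fixed
  by \<open>\<alpha>\<close> is finite and invariant under \<open>\<alpha>\<close>, hence fixed pointwise. If \<open>\<alpha>\<close> is fixed point free, it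
  is empty and the class is that of a constant.
\<close>


section \<open>Ultrafilters\<close>

definition ultrafilter :: "'a filter \<Rightarrow> bool" where
  "ultrafilter U \<longleftrightarrow> U \<noteq> bot \<and> (\<forall>P. eventually P U \<or> (\<forall>\<^sub>F x in U. \<not> P x))"

lemma ultrafilter_minimal:
  assumes "U \<noteq> bot" and min: "\<And>F. F \<noteq> bot \<Longrightarrow> F \<le> U \<Longrightarrow> F = U"
  shows "ultrafilter U"
  unfolding ultrafilter_def
proof (intro conjI allI disjCI)
  fix P assume "\<not> (\<forall>\<^sub>F x in U. \<not> P x)"
  then have "inf U (principal {x. P x}) \<noteq> bot"
    by (simp add: trivial_limit_def eventually_inf_principal)
  then have "inf U (principal {x. P x}) = U" by (rule min) simp
  moreover have "eventually P (inf U (principal {x. P x}))"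
    by (simp add: eventually_inf_principal)
  ultimately show "eventually P U" by simp
qed fact

lemma Inf_filter_chain_neq_bot:
  fixes C :: "'a filter set"
  assumes "C \<noteq> {}" "bot \<notin> C" and chain: "\<And>F G. F \<in> C \<Longrightarrow> G \<in> C \<Longrightarrow> F \<le> G \<or> G \<le> F"
  shows "Inf C \<noteq> bot"
proof
  assume "Inf C = bot"
  moreover have "\<exists>H\<in>C. H \<le> inf F G" if "F \<in> C" "G \<in> C" for F G
    using chain[OF that] that by (metis inf.absorb1 inf.absorb2 order_refl)
  ultimately have "\<exists>F\<in>C. eventually (\<lambda>_. False) F"
    using eventually_Inf_base[OF assms(1), of "\<lambda>_. False"] by simp
  then show False using assms(2) by (auto simp: eventually_False)
qed

lemma ultrafilter_exists:
  fixes F :: "'a filter"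
  assumes "F \<noteq> bot"
  obtains U where "ultrafilter U" "U \<le> F"
proof -
  let ?A = "{G. G \<noteq> bot \<and> G \<le> F}"
  have "\<exists>U\<in>?A. \<forall>G\<in>?A. G \<le> U \<longrightarrow> G = U"
  proof (rule predicate_Zorn)
    show "partial_order_on ?A (relation_of (\<lambda>G H. H \<le> G) ?A)"
      by (rule partial_order_on_relation_ofI) auto
    fix C assume "C \<in> Chains (relation_of (\<lambda>G H. H \<le> G) ?A)"
    then have sub: "C \<subseteq> ?A" and chain: "\<And>G H. G \<in> C \<Longrightarrow> H \<in> C \<Longrightarrow> G \<le> H \<or> H \<le> G"
      unfolding Chains_def relation_of_def by blast+
    show "\<exists>G\<in>?A. \<forall>H\<in>C. G \<le> H"
    proof (cases "C = {}")
      case False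
      then have "Inf C \<noteq> bot" using sub chain by (intro Inf_filter_chain_neq_bot) auto
      moreover have "Inf C \<le> F" using sub False by (auto intro: Inf_lower2)
      ultimately show ?thesis by (auto intro: Inf_lower)
    qed (use assms in blast)
  qed
  then obtain U where "U \<noteq> bot" "U \<le> F"
    and "\<And>G. G \<noteq> bot \<Longrightarrow> G \<le> F \<Longrightarrow> G \<le> U \<Longrightarrow> G = U" by blast
  then show thesis using that ultrafilter_minimal order_trans by metis
qed

lemma eventually_neq_cofinite: "U \<le> cofinite \<Longrightarrow> \<forall>\<^sub>F x in U. x \<noteq> a"
  by (erule filter_leD) (simp add: eventually_cofinite)


section \<open>Functions of finitely many coordinates\<close>

definition agree_on :: "'i set \<Rightarrow> ('i \<Rightarrow> 'n) rel" where
  "agree_on A = {(s, t). \<forall>i\<in>A. s i = t i}"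

abbreviation depends_on :: "'i set \<Rightarrow> (('i \<Rightarrow> 'n) \<Rightarrow> 'b) \<Rightarrow> bool" where
  "depends_on A f \<equiv> f respects agree_on A"

lemma agree_on_iff [simp]: "(s, t) \<in> agree_on A \<longleftrightarrow> (\<forall>i\<in>A. s i = t i)"
  by (simp add: agree_on_def)

lemma depends_onI: "(\<And>s t. (\<And>i. i \<in> A \<Longrightarrow> s i = t i) \<Longrightarrow> f s = f t) \<Longrightarrow> depends_on A f"
  unfolding congruent_def agree_on_def by blast

lemma depends_onD: "depends_on A f \<Longrightarrow> (\<And>i. i \<in> A \<Longrightarrow> s i = t i) \<Longrightarrow> f s = f t"
  unfolding congruent_def agree_on_def by blast

lemma depends_on_mono: "depends_on A f \<Longrightarrow> A \<subseteq> B \<Longrightarrow> depends_on B f"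
  unfolding congruent_def agree_on_def by blast

lemma depends_on_upd: "depends_on A f \<Longrightarrow> depends_on (A - {i}) (\<lambda>s. f (s(i := k)))"
  by (rule depends_onI) (auto elim: depends_onD)

lemma depends_on_upd_notin: "depends_on A f \<Longrightarrow> i \<notin> A \<Longrightarrow> f (s(i := k)) = f s"
  by (auto elim: depends_onD)

lemma depends_on_glue:
  fixes h :: "'n \<Rightarrow> ('i \<Rightarrow> 'n) \<Rightarrow> 'b"
  assumes "i \<in> A" and h: "\<And>k. depends_on (A - {i}) (h k)"
  shows "depends_on A (\<lambda>s. h (s i) s)"
proof (rule depends_onI)
  fix s t :: "'i \<Rightarrow> 'n" assume eq: "\<And>j. j \<in> A \<Longrightarrow> s j = t j"
  have "h (t i) s = h (t i) t" by (rule depends_onD[OF h]) (simp add: eq)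
  then show "h (s i) s = h (t i) t" using eq assms(1) by simp
qed

definition finite_agreements :: "'i set \<Rightarrow> ('i \<Rightarrow> 'n) rel set" where
  "finite_agreements I = {agree_on F | F. finite F \<and> F \<subseteq> I}"

lemma finite_agreements_directed:
  assumes "E \<in> finite_agreements I" "E' \<in> finite_agreements I"
  shows "\<exists>E''\<in>finite_agreements I. E'' \<subseteq> E \<inter> E'"
proof -
  obtain F F' where F: "finite F" "F \<subseteq> I" "E = agree_on F"
    and F': "finite F'" "F' \<subseteq> I" "E' = agree_on F'"
    using assms by (auto simp: finite_agreements_def)
  then have "agree_on (F \<union> F') \<in> finite_agreements I" by (auto simp: finite_agreements_def)
  moreover have "agree_on (F \<union> F') \<subseteq> E \<inter> E'" using F(3) F'(3) by auto
  ultimately show ?thesis by blast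
qed


section \<open>Increasing enumerations of finite subsets of a linear order\<close>

definition increasing_lists :: "'i set \<Rightarrow> 'i rel \<Rightarrow> 'i list set" where
  "increasing_lists I r = {xs. sorted_wrt (\<lambda>i j. (i, j) \<in> r) xs \<and> set xs \<subseteq> I}"

lemma increasing_lists_Nil [simp]: "[] \<in> increasing_lists I r"
  by (simp add: increasing_lists_def)

lemma increasing_lists_Cons [simp]:
  "i # xs \<in> increasing_lists I r \<longleftrightarrow>
     i \<in> I \<and> (\<forall>j\<in>set xs. (i, j) \<in> r) \<and> xs \<in> increasing_lists I r"
  by (auto simp: increasing_lists_def)

lemma increasing_lists_subset: "xs \<in> increasing_lists I r \<Longrightarrow> set xs \<subseteq> I"
  by (simp add: increasing_lists_def)

lemma increasing_lists_filter:
  "xs \<in> increasing_lists I r \<Longrightarrow> filter P xs \<in> increasing_lists I r"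
  by (auto simp: increasing_lists_def sorted_wrt_filter)

lemma increasing_lists_map:
  assumes "\<And>i. i \<in> I \<Longrightarrow> \<alpha> i \<in> I"
    and "\<And>i j. i \<in> I \<Longrightarrow> j \<in> I \<Longrightarrow> (i, j) \<in> r \<Longrightarrow> (\<alpha> i, \<alpha> j) \<in> r"
    and "xs \<in> increasing_lists I r"
  shows "map \<alpha> xs \<in> increasing_lists I r"
proof -
  have "sorted_wrt (\<lambda>i j. (\<alpha> i, \<alpha> j) \<in> r) xs"
    by (rule sorted_wrt_mono_rel[of _ "\<lambda>i j. (i, j) \<in> r"])
      (use assms in \<open>auto simp: increasing_lists_def\<close>)
  then show ?thesis using assms(1,3) by (auto simp: increasing_lists_def sorted_wrt_map)
qed

lemma increasing_list_unique:
  assumes "irrefl r" "trans r"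
    and "xs \<in> increasing_lists I r" "ys \<in> increasing_lists I r" "set xs = set ys"
  shows "xs = ys"
  using assms(3-)
proof (induction xs arbitrary: ys)
  case (Cons x xs)
  then obtain y ys' where ys: "ys = y # ys'" by (cases ys) auto
  have asym: "(j, i) \<notin> r" if "(i, j) \<in> r" for i j
    using that assms(1,2) by (meson irreflD transD)
  have "x = y"
  proof (rule ccontr)
    assume "x \<noteq> y"
    then have "x \<in> set ys'" "y \<in> set xs" using Cons.prems(3) unfolding ys by auto
    then show False using Cons.prems(1,2) asym unfolding ys by auto
  qed
  moreover have "x \<notin> set xs" "y \<notin> set ys'"
    using Cons.prems(1,2) assms(1) unfolding ys by (auto dest: irreflD)
  ultimately show ?case
    using Cons unfolding ys by (metis increasing_lists_Cons insert_ident list.set(2))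
qed simp

lemma increasing_list_exists:
  assumes "strict_linear_order_on I r" "finite F" "F \<subseteq> I"
  obtains xs where "xs \<in> increasing_lists I r" "set xs = F"
proof -
  have "\<exists>xs\<in>increasing_lists I r. set xs = F"
    using assms(2,3)
  proof (induction F)
    case (insert x F)
    then obtain xs where xs: "xs \<in> increasing_lists I r" "set xs = F" by auto
    have tr: "trans r" and tot: "total_on I r"
      using assms(1) by (auto simp: strict_linear_order_on_def)
    let ?ys = "filter (\<lambda>y. (y, x) \<in> r) xs @ x # filter (\<lambda>y. (x, y) \<in> r) xs"
    have "?ys \<in> increasing_lists I r"
      using xs insert.prems tr
      by (auto simp: increasing_lists_def sorted_wrt_append sorted_wrt_filter dest: transD)
    moreover have "set ?ys = insert x F"
      using xs(2) insert.hyps insert.prems tot unfolding total_on_def by auto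
    ultimately show ?case by blast
  qed (auto intro: bexI[of _ "[]"])
  then show thesis using that by blast
qed

lemma increasing_list_eq_filter:
  assumes "irrefl r" "trans r" "xs \<in> increasing_lists I r" "zs \<in> increasing_lists I r"
    and "set xs \<subseteq> set zs"
  shows "xs = filter (\<lambda>i. i \<in> set xs) zs"
  by (rule increasing_list_unique[OF assms(1-3) increasing_lists_filter[OF assms(4)]])
    (use assms(5) in auto)

lemma increasing_list_distinct:
  "irrefl r \<Longrightarrow> xs \<in> increasing_lists I r \<Longrightarrow> distinct xs"
  by (induction xs) (auto dest: irreflD)


section \<open>Order automorphisms\<close>

lemma Aut_order_simps:
  "carrier (Aut_order I r) = order_automorphisms I r"
  "\<one>\<^bsub>Aut_order I r\<^esub> = (\<lambda>i\<in>I. i)"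
  "\<alpha> \<in> order_automorphisms I r \<Longrightarrow> \<beta> \<in> order_automorphisms I r \<Longrightarrow>
    \<alpha> \<otimes>\<^bsub>Aut_order I r\<^esub> \<beta> = compose I \<alpha> \<beta>"
  by (simp_all add: Aut_order_def BijGroup_def order_automorphisms_def)

lemma order_automorphismD:
  assumes "\<alpha> \<in> order_automorphisms I r"
  shows "inj_on \<alpha> I" "i \<in> I \<Longrightarrow> \<alpha> i \<in> I" "\<alpha> \<in> extensional I"
    "i \<in> I \<Longrightarrow> j \<in> I \<Longrightarrow> (i, j) \<in> r \<Longrightarrow> (\<alpha> i, \<alpha> j) \<in> r"
  using assms by (auto simp: order_automorphisms_def Bij_def bij_betw_def)

lemma order_automorphism_inverse:
  assumes "\<alpha> \<in> order_automorphisms I r"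
  obtains \<beta> where "\<beta> \<in> order_automorphisms I r"
    "compose I \<alpha> \<beta> = (\<lambda>i\<in>I. i)" "compose I \<beta> \<alpha> = (\<lambda>i\<in>I. i)"
proof -
  interpret G: group "Aut_order I r" by (rule group_Aut_order)
  have \<alpha>: "\<alpha> \<in> carrier (Aut_order I r)" using assms by (simp add: Aut_order_simps)
  show thesis
    using that[of "inv\<^bsub>Aut_order I r\<^esub> \<alpha>"] G.inv_closed[OF \<alpha>] G.r_inv[OF \<alpha>] G.l_inv[OF \<alpha>] \<alpha>
    by (simp add: Aut_order_simps)
qed

lemma order_automorphism_map_increasing:
  "\<alpha> \<in> order_automorphisms I r \<Longrightarrow> xs \<in> increasing_lists I r \<Longrightarrow> map \<alpha> xs \<in> increasing_lists I r"
  by (rule increasing_lists_map) (auto intro: order_automorphismD)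


section \<open>Iterating a filter along a list of coordinates\<close>

definition filter_bind :: "'a filter \<Rightarrow> ('a \<Rightarrow> 'b filter) \<Rightarrow> 'b filter" where
  "filter_bind F G = Abs_filter (\<lambda>P. \<forall>\<^sub>F x in F. eventually P (G x))"

lemma eventually_filter_bind:
  "eventually P (filter_bind F G) \<longleftrightarrow> (\<forall>\<^sub>F x in F. eventually P (G x))"
  unfolding filter_bind_def
  by (rule eventually_Abs_filter, rule is_filter.intro)
    (auto simp: eventually_conj_iff elim!: eventually_mono)

primrec iterated_filter :: "'n filter \<Rightarrow> 'i list \<Rightarrow> ('i \<Rightarrow> 'n) filter" where
  "iterated_filter U [] = principal UNIV"
| "iterated_filter U (i # xs) =
     filter_bind U (\<lambda>k. filtermap (\<lambda>s. s(i := k)) (iterated_filter U xs))"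

lemma eventually_iterated_filter_Cons [simp]:
  "eventually P (iterated_filter U (i # xs)) \<longleftrightarrow>
     (\<forall>\<^sub>F k in U. \<forall>\<^sub>F s in iterated_filter U xs. P (s(i := k)))"
  by (simp add: eventually_filter_bind eventually_filtermap)

declare iterated_filter.simps(2) [simp del]

lemma iterated_filter_neq_bot: "U \<noteq> bot \<Longrightarrow> iterated_filter U xs \<noteq> bot"
  by (induction xs) (simp_all add: trivial_limit_def eventually_principal)

lemma iterated_filter_decides:
  assumes "ultrafilter U" "depends_on (set xs) P"
  shows "eventually P (iterated_filter U xs) \<or> (\<forall>\<^sub>F s in iterated_filter U xs. \<not> P s)"
  using assms(2)
proof (induction xs arbitrary: P)
  case Nil
  then have "P s = P t" for s t by (rule depends_onD) simp
  then show ?case by simp blast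
next
  case (Cons i xs)
  let ?now = "\<lambda>k. \<forall>\<^sub>F s in iterated_filter U xs. P (s(i := k))"
  let ?not = "\<lambda>k. \<forall>\<^sub>F s in iterated_filter U xs. \<not> P (s(i := k))"
  have step: "?now k \<or> ?not k" for k
    by (rule Cons.IH, rule depends_on_mono[OF depends_on_upd[OF Cons.prems]]) auto
  have "eventually ?now U \<or> (\<forall>\<^sub>F k in U. \<not> ?now k)"
    using assms(1) unfolding ultrafilter_def by blast
  moreover have "eventually ?not U" if "\<forall>\<^sub>F k in U. \<not> ?now k"
    using that by (rule eventually_mono) (use step in blast)
  ultimately show ?case by auto
qed

lemma iterated_filter_upd_notin:
  assumes "i \<notin> set xs" "eventually P (iterated_filter U xs)"
  shows "\<forall>\<^sub>F s in iterated_filter U xs. P (s(i := k))"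
  using assms
proof (induction xs arbitrary: P)
  case (Cons j xs)
  have neq: "i \<noteq> j" "i \<notin> set xs" using Cons.prems(1) by auto
  have "\<forall>\<^sub>F s in iterated_filter U xs. P (s(j := l, i := k))"
    if "\<forall>\<^sub>F s in iterated_filter U xs. P (s(j := l))" for l
    by (rule eventually_mono[OF Cons.IH[OF neq(2) that]]) (metis fun_upd_twist neq(1))
  then show ?case using Cons.prems(2) by (auto elim: eventually_mono simp del: fun_upd_apply)
qed simp

lemma iterated_filter_le_filter:
  "distinct zs \<Longrightarrow> iterated_filter U zs \<le> iterated_filter U (filter Q zs)"
  unfolding le_filter_def
proof (intro allI impI, induction zs)
  case (Cons i zs)
  show ?case
  proof (cases "Q i")
    case True
    then show ?thesis using Cons by (auto elim!: eventually_mono)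
  next
    case False
    then show ?thesis using Cons by (simp add: iterated_filter_upd_notin)
  qed
qed simp

lemma iterated_filter_glue:
  assumes "i \<in> A"
    and "\<forall>\<^sub>F k in U. \<exists>h. depends_on (A - {i}) h \<and>
      (\<forall>\<^sub>F s in iterated_filter U xs. h s = f (s(i := k)))"
  shows "\<exists>h. depends_on A h \<and> (\<forall>\<^sub>F s in iterated_filter U (i # xs). h s = f s)"
proof -
  let ?good = "\<lambda>k h. \<forall>\<^sub>F s in iterated_filter U xs. h s = f (s(i := k))"
  let ?ex = "\<lambda>k. \<exists>h. depends_on (A - {i}) h \<and> ?good k h"
  have "\<exists>h. \<forall>k. depends_on (A - {i}) (h k) \<and> (?ex k \<longrightarrow> ?good k (h k))"
    using congruentI[of "agree_on (A - {i})" "\<lambda>_. undefined"] by (intro choice allI) blast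
  then obtain h where h: "\<And>k. depends_on (A - {i}) (h k)" "\<And>k. ?ex k \<Longrightarrow> ?good k (h k)"
    by blast
  have "h k (s(i := k)) = h k s" for k s by (rule depends_on_upd_notin[OF h(1)]) simp
  then have "\<forall>\<^sub>F s in iterated_filter U (i # xs). h (s i) s = f s"
    using eventually_mono[OF assms(2) h(2)] by simp
  then show ?thesis using depends_on_glue[of i A h, OF assms(1) h(1)] by blast
qed

text \<open>A coordinate outside \<open>A \<inter> B\<close> is frozen at a typical value.\<close>

lemma iterated_filter_freeze:
  assumes "U \<noteq> bot" "i \<notin> A \<inter> B" "depends_on A f" "depends_on B g"
    and fg: "\<forall>\<^sub>F s in iterated_filter U (i # xs). f s = g s"
    and "\<forall>\<^sub>F k in U. \<exists>h. depends_on (A \<inter> B - {i}) h \<and>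
      (\<forall>\<^sub>F s in iterated_filter U xs. h s = f (s(i := k)))"
  shows "\<exists>h. depends_on (A \<inter> B) h \<and> (\<forall>\<^sub>F s in iterated_filter U (i # xs). h s = f s)"
proof -
  have "\<forall>\<^sub>F k in U. \<forall>\<^sub>F s in iterated_filter U xs. f (s(i := k)) = g (s(i := k))"
    using fg by simp
  from eventually_happens'[OF assms(1) eventually_conj[OF this assms(6)]]
  obtain k h where k: "\<forall>\<^sub>F s in iterated_filter U xs. f (s(i := k)) = g (s(i := k))"
    and h: "depends_on (A \<inter> B) h"
    and hf: "\<forall>\<^sub>F s in iterated_filter U xs. h s = f (s(i := k))"
    using assms(2) by auto
  have frozen: "\<forall>\<^sub>F s in iterated_filter U xs. h s = f (s(i := k)) \<and> h s = g (s(i := k))"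
    using hf k by eventually_elim simp
  have "\<forall>\<^sub>F s in iterated_filter U xs.
      h (s(i := l)) = f (s(i := l)) \<or> h (s(i := l)) = g (s(i := l))" for l
    by (rule eventually_mono[OF frozen])
      (use assms(2) depends_on_upd_notin[OF h] depends_on_upd_notin[OF assms(3)]
        depends_on_upd_notin[OF assms(4)] in \<open>metis IntI\<close>)
  then have "\<forall>\<^sub>F s in iterated_filter U (i # xs). h s = f s \<or> h s = g s" by simp
  then have "\<forall>\<^sub>F s in iterated_filter U (i # xs). h s = f s"
    using fg by (rule eventually_elim2) auto
  with h show ?thesis by blast
qed

lemma iterated_filter_common_support:
  assumes "U \<noteq> bot" "A \<union> B \<subseteq> set xs" "depends_on A f" "depends_on B g"
    and "\<forall>\<^sub>F s in iterated_filter U xs. f s = g s"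
  shows "\<exists>h. depends_on (A \<inter> B) h \<and> (\<forall>\<^sub>F s in iterated_filter U xs. h s = f s)"
  using assms(2-)
proof (induction xs arbitrary: A B f g)
  case Nil
  then show ?case by auto
next
  case (Cons i xs)
  have "\<exists>h. depends_on (A \<inter> B - {i}) h \<and> (\<forall>\<^sub>F s in iterated_filter U xs. h s = f (s(i := k)))"
    if "\<forall>\<^sub>F s in iterated_filter U xs. f (s(i := k)) = g (s(i := k))" for k
  proof -
    have "(A - {i}) \<union> (B - {i}) \<subseteq> set xs" using Cons.prems(1) by auto
    from Cons.IH[OF this depends_on_upd[OF Cons.prems(2)] depends_on_upd[OF Cons.prems(3)] that]
    show ?thesis by (simp add: Int_Diff Diff_Int_distrib2 del: fun_upd_apply)
  qed
  moreover have "\<forall>\<^sub>F k in U. \<forall>\<^sub>F s in iterated_filter U xs. f (s(i := k)) = g (s(i := k))"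
    using Cons.prems(4) by simp
  ultimately have step: "\<forall>\<^sub>F k in U. \<exists>h. depends_on (A \<inter> B - {i}) h \<and>
      (\<forall>\<^sub>F s in iterated_filter U xs. h s = f (s(i := k)))"
    by (auto elim: eventually_mono)
  show ?case
  proof (cases "i \<in> A \<inter> B")
    case True
    then show ?thesis using step by (rule iterated_filter_glue)
  next
    case False
    from iterated_filter_freeze[OF assms(1) this Cons.prems(2-4) step] show ?thesis .
  qed
qed

lemma filterlim_iterated_filter_map:
  assumes "inj_on \<alpha> I" "set xs \<subseteq> I"
  shows "filterlim (\<lambda>s. compose I s \<alpha>) (iterated_filter U xs) (iterated_filter U (map \<alpha> xs))"
  unfolding filterlim_iff using assms(2)
proof (intro allI impI, induction xs)
  case (Cons i xs)
  have upd: "compose I (s(\<alpha> i := k)) \<alpha> = (compose I s \<alpha>)(i := k)" for s k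
    using assms(1) Cons.prems(1) by (auto simp: compose_def fun_eq_iff dest: inj_onD)
  have "\<forall>\<^sub>F k in U. \<forall>\<^sub>F s in iterated_filter U xs. P (s(i := k))" using Cons.prems(2) by simp
  then have "\<forall>\<^sub>F k in U. \<forall>\<^sub>F s in iterated_filter U (map \<alpha> xs). P ((compose I s \<alpha>)(i := k))"
    by (rule eventually_mono) (rule Cons.IH, use Cons.prems(1) in \<open>simp_all del: fun_upd_apply\<close>)
  then show ?case by (simp add: upd)
qed simp


section \<open>Free variables\<close>

fun trm_vars :: "'f trm \<Rightarrow> nat set" where
  "trm_vars (Var n) = {n}"
| "trm_vars (Fn f ts) = (\<Union>t\<in>set ts. trm_vars t)"

fun free_vars :: "('f, 'r) fm \<Rightarrow> nat set" where
  "free_vars (Eq s t) = trm_vars s \<union> trm_vars t"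
| "free_vars (Rel r ts) = (\<Union>t\<in>set ts. trm_vars t)"
| "free_vars (Neg p) = free_vars p"
| "free_vars (Conj p q) = free_vars p \<union> free_vars q"
| "free_vars (Ex n p) = free_vars p - {n}"

lemma finite_trm_vars: "finite (trm_vars t)"
  by (induction t) auto

lemma finite_free_vars: "finite (free_vars p)"
  by (induction p) (auto simp: finite_trm_vars)

lemma eval_cong: "(\<And>n. n \<in> trm_vars t \<Longrightarrow> d n = e n) \<Longrightarrow> eval M d t = eval M e t"
proof (induction t)
  case (Fn f ts)
  then have "map (eval M d) ts = map (eval M e) ts" by auto
  then show ?case by (simp only: eval.simps)
qed simp

lemma sat_cong: "(\<And>n. n \<in> free_vars p \<Longrightarrow> d n = e n) \<Longrightarrow> sat M d p \<longleftrightarrow> sat M e p"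
proof (induction p arbitrary: d e)
  case (Eq s t)
  then show ?case using eval_cong[of s d e M] eval_cong[of t d e M] by simp
next
  case (Rel r ts)
  then have "map (eval M d) ts = map (eval M e) ts" by (auto intro!: eval_cong)
  then show ?case by (simp only: sat.simps)
next
  case (Neg p)
  have "sat M d p \<longleftrightarrow> sat M e p" by (rule Neg.IH) (simp add: Neg.prems)
  then show ?case by simp
next
  case (Conj p q)
  have "sat M d p \<longleftrightarrow> sat M e p" "sat M d q \<longleftrightarrow> sat M e q"
    by (rule Conj.IH, simp add: Conj.prems)+
  then show ?case by simp
next
  case (Ex n p)
  have "sat M (d(n := a)) p \<longleftrightarrow> sat M (e(n := a)) p" for a
    by (rule Ex.IH) (simp add: Ex.prems)
  then show ?case by simp
qed


section \<open>Recognising elementary extensions\<close>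

lemma fun_int_closed:
  "is_struct L M \<Longrightarrow> f \<in> fun_syms L \<Longrightarrow> xs \<in> tuples (universe M) (fun_arity L f) \<Longrightarrow>
     fun_int M f xs \<in> universe M"
  by (simp add: is_struct_def)

lemma is_struct_struct_copy:
  assumes "is_struct L M" "inj_on j (universe M)"
  shows "is_struct L (struct_copy j M)"
proof -
  have "map (inv_into (universe M) j) ys \<in> tuples (universe M) n"
    if "ys \<in> tuples (j ` universe M) n" for ys n
    using that assms(2) by (auto simp: tuples_def)
  then show ?thesis using assms(1) by (auto simp: is_struct_def)
qed

lemma map_nth_valuation:
  "map (eval M (\<lambda>k. if k < length xs then xs ! k else y)) (map Var [0..<length xs]) = xs"
  by (auto intro: nth_equalityI)

lemma elem_extensionI:
  assumes M: "is_struct L M" and N: "is_struct L N" and sub: "universe M \<subseteq> universe N"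
    and sat: "\<And>p e. is_fm L p \<Longrightarrow> range e \<subseteq> universe M \<Longrightarrow> sat M e p \<longleftrightarrow> sat N e p"
  shows "elem_extension L M N"
proof -
  let ?e = "\<lambda>xs y k. if k < length xs then xs ! k else y"
  let ?vars = "\<lambda>n. map Var [0..<n] :: 'a trm list"
  have range_e: "range (?e xs y) \<subseteq> universe M"
    if "xs \<in> tuples (universe M) n" "y \<in> universe M" for xs y n
    using that by (auto simp: tuples_def)
  have "fun_int M f xs = fun_int N f xs"
    if f: "f \<in> fun_syms L" and xs: "xs \<in> tuples (universe M) (fun_arity L f)" for f xs
  proof -
    let ?p = "Eq (Fn f (?vars (length xs))) (Var (length xs))"
    have "is_fm L ?p" using f xs by (simp add: tuples_def)
    from sat[OF this range_e[OF xs fun_int_closed[OF M f xs]]] show ?thesis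
      by (simp add: map_nth_valuation del: map_map)
  qed
  moreover have "rel_int M r xs \<longleftrightarrow> rel_int N r xs"
    if r: "r \<in> rel_syms L" and xs: "xs \<in> tuples (universe M) (rel_arity L r)" for r xs
  proof -
    obtain y where y: "y \<in> universe M" using M by (auto simp: is_struct_def)
    have "is_fm L (Rel r (?vars (length xs)))" using r xs by (simp add: tuples_def)
    from sat[OF this range_e[OF xs y]] show ?thesis
      by (simp add: map_nth_valuation del: map_map)
  qed
  ultimately show ?thesis using M N sub sat by (simp add: elem_extension_def substruct_def)
qed


section \<open>Limit ultrapowers\<close>

text \<open>
  Keisler's limit ultrapower: only those functions on the index set are admitted that respect one of
  the relations in a given directed family, and \<open>D\<close> need only decide the admitted predicates.
\<close>

locale limit_ultrapower =
  fixes L :: "('f, 'r) language"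
    and M :: "('f, 'r, 'm) fo_struct"
    and D :: "'s filter"
    and \<E> :: "'s rel set"
  assumes is_struct_M: "is_struct L M"
    and family_nonempty: "\<E> \<noteq> {}"
    and family_directed: "E \<in> \<E> \<Longrightarrow> E' \<in> \<E> \<Longrightarrow> \<exists>E''\<in>\<E>. E'' \<subseteq> E \<inter> E'"
    and filter_neq_bot: "D \<noteq> bot"
    and filter_decides: "E \<in> \<E> \<Longrightarrow> P respects E \<Longrightarrow> eventually P D \<or> (\<forall>\<^sub>F s in D. \<not> P s)"
begin

definition admissible :: "('s \<Rightarrow> 'b) \<Rightarrow> bool" where
  "admissible f \<longleftrightarrow> (\<exists>E\<in>\<E>. f respects E)"

lemma eventually_not_iff:
  assumes "admissible P"
  shows "(\<forall>\<^sub>F s in D. \<not> P s) \<longleftrightarrow> \<not> eventually P D"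
proof -
  have "\<not> (eventually P D \<and> (\<forall>\<^sub>F s in D. \<not> P s))"
    using filter_neq_bot by (auto simp: trivial_limit_def dest: eventually_conj)
  then show ?thesis using assms filter_decides unfolding admissible_def by blast
qed

lemma common_respected_relation:
  assumes "finite K" "\<And>k. k \<in> K \<Longrightarrow> admissible (f k)"
  shows "\<exists>E\<in>\<E>. \<forall>k\<in>K. f k respects E"
  using assms
proof (induction K)
  case empty
  then show ?case using family_nonempty by auto
next
  case (insert k K)
  then obtain E where E: "E \<in> \<E>" "\<forall>k\<in>K. f k respects E" by auto
  obtain E' where E': "E' \<in> \<E>" "f k respects E'"
    using insert.prems unfolding admissible_def by auto
  obtain E'' where "E'' \<in> \<E>" "E'' \<subseteq> E \<inter> E'" using family_directed[OF E(1) E'(1)] by blast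
  with E(2) E'(2) show ?case unfolding congruent_def by blast
qed

lemma admissible_determined:
  assumes "finite K" "\<And>k. k \<in> K \<Longrightarrow> admissible (f k)"
    and "\<And>s t. (\<And>k. k \<in> K \<Longrightarrow> f k s = f k t) \<Longrightarrow> g s = g t"
  shows "admissible g"
proof -
  obtain E where "E \<in> \<E>" "\<forall>k\<in>K. f k respects E"
    using common_respected_relation[OF assms(1), of f] assms(2) by blast
  then have "g respects E" by (intro congruentI assms(3)) (auto dest: congruentD)
  with \<open>E \<in> \<E>\<close> show ?thesis unfolding admissible_def by blast
qed

lemma admissible_const: "admissible (\<lambda>_. c)"
  by (rule admissible_determined[of "{}"]) auto

definition maps :: "('s \<Rightarrow> 'm) set" where
  "maps = {f. admissible f \<and> range f \<subseteq> universe M}"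

lemma maps_admissible: "f \<in> maps \<Longrightarrow> admissible f"
  by (simp add: maps_def)

lemma maps_closed: "f \<in> maps \<Longrightarrow> f s \<in> universe M"
  by (auto simp: maps_def)

lemma maps_const [simp]: "(\<lambda>_. m) \<in> maps \<longleftrightarrow> m \<in> universe M"
  by (auto simp: maps_def admissible_const)

lemma maps_fun_int:
  assumes "f \<in> fun_syms L" "length xs = fun_arity L f" "\<And>x. x \<in> set xs \<Longrightarrow> g x \<in> maps"
  shows "(\<lambda>s. fun_int M f (map (\<lambda>x. g x s) xs)) \<in> maps"
proof -
  have "map (\<lambda>x. g x s) xs \<in> tuples (universe M) (fun_arity L f)" for s
    using assms by (auto simp: tuples_def maps_closed)
  then have "fun_int M f (map (\<lambda>x. g x s) xs) \<in> universe M" for s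
    by (rule fun_int_closed[OF is_struct_M assms(1)])
  moreover have "admissible (\<lambda>s. fun_int M f (map (\<lambda>x. g x s) xs))"
    by (rule admissible_determined[of "set xs" g])
      (auto simp: assms(3) maps_admissible cong: map_cong)
  ultimately show ?thesis by (auto simp: maps_def)
qed

text \<open>
  A germ is named by one of its members, or by the value if it contains a constant function: this
  makes the extension contain \<open>M\<close> itself.
\<close>

definition germ :: "('s \<Rightarrow> 'm) \<Rightarrow> 'm + ('s \<Rightarrow> 'm)" where
  "germ f = (if \<exists>m\<in>universe M. \<forall>\<^sub>F s in D. f s = m
     then Inl (SOME m. m \<in> universe M \<and> (\<forall>\<^sub>F s in D. f s = m))
     else Inr (SOME g. g \<in> maps \<and> (\<forall>\<^sub>F s in D. g s = f s)))"

definition germ_rep :: "'m + ('s \<Rightarrow> 'm) \<Rightarrow> 's \<Rightarrow> 'm" where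
  "germ_rep = case_sum (\<lambda>m _. m) (\<lambda>g. g)"

lemma germ_rep_germ:
  assumes "f \<in> maps"
  shows "germ_rep (germ f) \<in> maps \<and> (\<forall>\<^sub>F s in D. germ_rep (germ f) s = f s)"
proof (cases "\<exists>m\<in>universe M. \<forall>\<^sub>F s in D. f s = m")
  case True
  then have "\<exists>m. m \<in> universe M \<and> (\<forall>\<^sub>F s in D. f s = m)" by blast
  from someI_ex[OF this] True show ?thesis by (simp add: germ_def germ_rep_def eq_commute)
next
  case False
  have "\<exists>g. g \<in> maps \<and> (\<forall>\<^sub>F s in D. g s = f s)" using assms by (intro exI[of _ f]) simp
  from someI_ex[OF this] False show ?thesis by (simp add: germ_def germ_rep_def)
qed

lemmas germ_rep_maps = germ_rep_germ[THEN conjunct1]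
  and eventually_germ_rep_eq = germ_rep_germ[THEN conjunct2]

lemma germ_cong:
  assumes "\<forall>\<^sub>F s in D. f s = g s"
  shows "germ f = germ g"
proof -
  have "(\<forall>\<^sub>F s in D. f s = h s) \<longleftrightarrow> (\<forall>\<^sub>F s in D. g s = h s)"
    "(\<forall>\<^sub>F s in D. h s = f s) \<longleftrightarrow> (\<forall>\<^sub>F s in D. h s = g s)" for h
    by (rule eventually_cong[OF assms], simp)+
  then show ?thesis unfolding germ_def by presburger
qed

lemma germ_eq_iff:
  assumes "f \<in> maps" "g \<in> maps"
  shows "germ f = germ g \<longleftrightarrow> (\<forall>\<^sub>F s in D. f s = g s)"
proof
  assume "germ f = germ g"
  with eventually_germ_rep_eq[OF assms(1)] eventually_germ_rep_eq[OF assms(2)]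
  show "\<forall>\<^sub>F s in D. f s = g s" by (auto elim: eventually_elim2)
qed (rule germ_cong)

lemma germ_const:
  assumes "m \<in> universe M"
  shows "germ (\<lambda>_. m) = Inl m"
proof -
  have "(SOME k. k \<in> universe M \<and> m = k) = m" using assms by (intro some_equality) auto
  then show ?thesis using assms filter_neq_bot by (simp add: germ_def)
qed

lemma germ_in_Inl:
  assumes "germ f \<in> Inl ` universe M"
  shows "\<exists>m\<in>universe M. \<forall>\<^sub>F s in D. f s = m"
  using assms by (auto simp: germ_def split: if_splits)

lemma eventually_map_germ_rep:
  assumes "\<And>x. x \<in> set xs \<Longrightarrow> g x \<in> maps"
  shows "\<forall>\<^sub>F s in D. map (\<lambda>x. germ_rep (germ (g x)) s) xs = map (\<lambda>x. g x s) xs"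
  using eventually_germ_rep_eq[OF assms] by (simp add: eventually_ball_finite_distrib)

definition limit_power :: "('f, 'r, 'm + ('s \<Rightarrow> 'm)) fo_struct" where
  "limit_power = \<lparr>universe = germ ` maps,
     fun_int = \<lambda>f xs. germ (\<lambda>s. fun_int M f (map (\<lambda>x. germ_rep x s) xs)),
     rel_int = \<lambda>r xs. \<forall>\<^sub>F s in D. rel_int M r (map (\<lambda>x. germ_rep x s) xs)\<rparr>"

lemma limit_power_simps [simp]:
  "universe limit_power = germ ` maps"
  "fun_int limit_power f xs = germ (\<lambda>s. fun_int M f (map (\<lambda>x. germ_rep x s) xs))"
  "rel_int limit_power r xs \<longleftrightarrow> (\<forall>\<^sub>F s in D. rel_int M r (map (\<lambda>x. germ_rep x s) xs))"
  by (simp_all add: limit_power_def)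

lemma fun_int_limit_power:
  assumes "\<And>x. x \<in> set xs \<Longrightarrow> g x \<in> maps"
  shows "fun_int limit_power f (map (\<lambda>x. germ (g x)) xs) =
    germ (\<lambda>s. fun_int M f (map (\<lambda>x. g x s) xs))"
proof -
  have rep: "\<forall>\<^sub>F s in D. map (\<lambda>x. germ_rep (germ (g x)) s) xs = map (\<lambda>x. g x s) xs"
    using assms by (rule eventually_map_germ_rep)
  have "\<forall>\<^sub>F s in D. fun_int M f (map (\<lambda>x. germ_rep (germ (g x)) s) xs) =
      fun_int M f (map (\<lambda>x. g x s) xs)"
    by (rule eventually_mono[OF rep]) (erule arg_cong)
  then show ?thesis by (simp add: comp_def germ_cong)
qed

lemma rel_int_limit_power:
  assumes "\<And>x. x \<in> set xs \<Longrightarrow> g x \<in> maps"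
  shows "rel_int limit_power r (map (\<lambda>x. germ (g x)) xs) \<longleftrightarrow>
    (\<forall>\<^sub>F s in D. rel_int M r (map (\<lambda>x. g x s) xs))"
proof -
  have rep: "\<forall>\<^sub>F s in D. map (\<lambda>x. germ_rep (germ (g x)) s) xs = map (\<lambda>x. g x s) xs"
    using assms by (rule eventually_map_germ_rep)
  have "(\<forall>\<^sub>F s in D. rel_int M r (map (\<lambda>x. germ_rep (germ (g x)) s) xs)) \<longleftrightarrow>
      (\<forall>\<^sub>F s in D. rel_int M r (map (\<lambda>x. g x s) xs))"
    by (rule eventually_cong[OF rep]) (erule arg_cong)
  then show ?thesis by (simp add: comp_def)
qed

lemma is_struct_limit_power: "is_struct L limit_power"
proof -
  obtain m where "m \<in> universe M" using is_struct_M by (auto simp: is_struct_def)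
  then have "maps \<noteq> {}" using maps_const by blast
  moreover have "fun_int limit_power f xs \<in> universe limit_power"
    if "f \<in> fun_syms L" "xs \<in> tuples (universe limit_power) (fun_arity L f)" for f xs
    using that by (auto simp: tuples_def subset_iff intro!: imageI maps_fun_int germ_rep_maps)
  ultimately show ?thesis unfolding is_struct_def by auto
qed

lemma eval_limit_power:
  assumes "is_trm L t" and d: "\<And>k. d k \<in> maps"
  shows "(\<lambda>s. eval M (\<lambda>k. d k s) t) \<in> maps \<and>
    eval limit_power (\<lambda>k. germ (d k)) t = germ (\<lambda>s. eval M (\<lambda>k. d k s) t)"
  using assms(1)
proof (induction t)
  case (Var n)
  then show ?case using d[of n] by simp
next
  case (Fn f ts)
  let ?g = "\<lambda>t s. eval M (\<lambda>k. d k s) t"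
  have g: "?g t \<in> maps" "eval limit_power (\<lambda>k. germ (d k)) t = germ (?g t)" if "t \<in> set ts" for t
    using Fn that by auto
  have ts: "map (eval limit_power (\<lambda>k. germ (d k))) ts = map (\<lambda>t. germ (?g t)) ts"
    using g by simp
  have "eval limit_power (\<lambda>k. germ (d k)) (Fn f ts) = germ (\<lambda>s. fun_int M f (map (\<lambda>t. ?g t s) ts))"
    unfolding eval.simps ts by (rule fun_int_limit_power[OF g(1)])
  moreover have "(\<lambda>s. fun_int M f (map (\<lambda>t. ?g t s) ts)) \<in> maps"
    using Fn.prems g(1) by (intro maps_fun_int) auto
  ultimately show ?case by simp
qed

lemma admissible_sat:
  assumes "\<And>k. d k \<in> maps"
  shows "admissible (\<lambda>s. sat M (\<lambda>k. d k s) p)"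
proof (rule admissible_determined[OF finite_free_vars[of p], of d])
  show "sat M (\<lambda>k. d k s) p \<longleftrightarrow> sat M (\<lambda>k. d k t) p" if "\<And>k. k \<in> free_vars p \<Longrightarrow> d k s = d k t" for s t
    using that by (rule sat_cong)
qed (simp add: assms maps_admissible)

lemma witness_map_exists:
  assumes "\<And>k. d k \<in> maps"
  shows "\<exists>f\<in>maps. \<forall>s. sat M (\<lambda>k. d k s) (Ex n p) \<longrightarrow> sat M ((\<lambda>k. d k s)(n := f s)) p"
proof -
  let ?W = "\<lambda>s a. a \<in> universe M \<and> (sat M (\<lambda>k. d k s) (Ex n p) \<longrightarrow> sat M ((\<lambda>k. d k s)(n := a)) p)"
  define f where "f s = (SOME a. ?W s a)" for s
  have "\<exists>a. ?W s a" for s using is_struct_M unfolding is_struct_def sat.simps by blast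
  then have W: "?W s (f s)" for s unfolding f_def by (rule someI_ex)
  have "admissible f"
  proof (rule admissible_determined[OF finite_free_vars[of "Ex n p"], of d])
    fix s t assume eq: "\<And>k. k \<in> free_vars (Ex n p) \<Longrightarrow> d k s = d k t"
    have "sat M ((\<lambda>k. d k s)(n := a)) p \<longleftrightarrow> sat M ((\<lambda>k. d k t)(n := a)) p" for a
      by (rule sat_cong) (use eq in simp)
    then show "f s = f t" unfolding f_def by simp
  qed (simp add: assms maps_admissible)
  then have "f \<in> maps" using W by (auto simp: maps_def)
  then show ?thesis using W by blast
qed

lemma eventually_sat_Ex_iff:
  assumes "\<And>k. d k \<in> maps"
  shows "(\<forall>\<^sub>F s in D. sat M (\<lambda>k. d k s) (Ex n p)) \<longleftrightarrow>
    (\<exists>f\<in>maps. \<forall>\<^sub>F s in D. sat M ((\<lambda>k. d k s)(n := f s)) p)"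
proof
  assume witnessed: "\<forall>\<^sub>F s in D. sat M (\<lambda>k. d k s) (Ex n p)"
  obtain f where f: "f \<in> maps"
    and W: "\<And>s. sat M (\<lambda>k. d k s) (Ex n p) \<Longrightarrow> sat M ((\<lambda>k. d k s)(n := f s)) p"
    using witness_map_exists[of d n p] assms by blast
  have "\<forall>\<^sub>F s in D. sat M ((\<lambda>k. d k s)(n := f s)) p" by (rule eventually_mono[OF witnessed W])
  with f show "\<exists>f\<in>maps. \<forall>\<^sub>F s in D. sat M ((\<lambda>k. d k s)(n := f s)) p" by blast
next
  assume "\<exists>f\<in>maps. \<forall>\<^sub>F s in D. sat M ((\<lambda>k. d k s)(n := f s)) p"
  then obtain f where f: "f \<in> maps" "\<forall>\<^sub>F s in D. sat M ((\<lambda>k. d k s)(n := f s)) p" by blast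
  show "\<forall>\<^sub>F s in D. sat M (\<lambda>k. d k s) (Ex n p)"
    by (rule eventually_mono[OF f(2)]) (use maps_closed[OF f(1)] in auto)
qed

theorem Los:
  assumes "is_fm L p" and "\<And>k. d k \<in> maps"
  shows "sat limit_power (\<lambda>k. germ (d k)) p \<longleftrightarrow> (\<forall>\<^sub>F s in D. sat M (\<lambda>k. d k s) p)"
  using assms
proof (induction p arbitrary: d)
  case (Eq s t)
  then show ?case using eval_limit_power[of s d] eval_limit_power[of t d] by (simp add: germ_eq_iff)
next
  case (Rel r ts)
  let ?g = "\<lambda>t s. eval M (\<lambda>k. d k s) t"
  have g: "?g t \<in> maps" "eval limit_power (\<lambda>k. germ (d k)) t = germ (?g t)" if "t \<in> set ts" for t
    using Rel that eval_limit_power[of t d] by auto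
  have ts: "map (eval limit_power (\<lambda>k. germ (d k))) ts = map (\<lambda>t. germ (?g t)) ts"
    using g by simp
  have "sat limit_power (\<lambda>k. germ (d k)) (Rel r ts) \<longleftrightarrow>
      (\<forall>\<^sub>F s in D. rel_int M r (map (\<lambda>t. ?g t s) ts))"
    unfolding sat.simps ts by (rule rel_int_limit_power[OF g(1)])
  then show ?case by simp
next
  case (Neg p)
  then show ?case using eventually_not_iff[OF admissible_sat, of d p] by simp
next
  case (Conj p q)
  then show ?case by (simp add: eventually_conj_iff)
next
  case (Ex n p)
  have upd: "(\<lambda>k. germ (d k))(n := germ f) = (\<lambda>k. germ ((d(n := f)) k))"
    "(\<lambda>k. d k s)(n := f s) = (\<lambda>k. (d(n := f)) k s)" for f s by auto
  have IH: "sat limit_power ((\<lambda>k. germ (d k))(n := germ f)) p \<longleftrightarrow>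
      (\<forall>\<^sub>F s in D. sat M ((\<lambda>k. d k s)(n := f s)) p)" if "f \<in> maps" for f
    unfolding upd by (rule Ex.IH) (use Ex.prems that in auto)
  have "sat limit_power (\<lambda>k. germ (d k)) (Ex n p) \<longleftrightarrow>
      (\<exists>f\<in>maps. \<forall>\<^sub>F s in D. sat M ((\<lambda>k. d k s)(n := f s)) p)"
    using IH by auto
  also have "\<dots> \<longleftrightarrow> (\<forall>\<^sub>F s in D. sat M (\<lambda>k. d k s) (Ex n p))"
    by (rule eventually_sat_Ex_iff[symmetric, OF Ex.prems(2)])
  finally show ?case .
qed

lemma elem_extension_limit_power: "elem_extension L (struct_copy Inl M) limit_power"
proof (rule elem_extensionI)
  show "is_struct L (struct_copy Inl M)" by (simp add: is_struct_struct_copy is_struct_M)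
  show "is_struct L limit_power" by (rule is_struct_limit_power)
  have "Inl m \<in> germ ` maps" if "m \<in> universe M" for m
    using that imageI[of "\<lambda>_. m" maps germ] by (simp add: germ_const)
  then show "universe (struct_copy Inl M) \<subseteq> universe limit_power" by auto
next
  fix p and e :: "nat \<Rightarrow> 'm + ('s \<Rightarrow> 'm)"
  assume p: "is_fm L p" and "range e \<subseteq> universe (struct_copy Inl M)"
  then have "\<forall>k. \<exists>m\<in>universe M. e k = Inl m" by auto
  then obtain d where d: "\<And>k. d k \<in> universe M" "e = (\<lambda>k. Inl (d k))" by metis
  then have "sat (struct_copy Inl M) e p \<longleftrightarrow> sat M d p"
    using sat_struct_copy[OF is_struct_M _ p, of Inl d] by auto
  also have "\<dots> \<longleftrightarrow> sat limit_power e p"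
    using Los[OF p, of "\<lambda>k _. d k"] d filter_neq_bot by (simp add: germ_const)
  finally show "sat (struct_copy Inl M) e p \<longleftrightarrow> sat limit_power e p" .
qed


section \<open>Automorphisms induced by maps of the index set\<close>

definition index_map :: "('s \<Rightarrow> 's) \<Rightarrow> bool" where
  "index_map \<phi> \<longleftrightarrow> filterlim \<phi> D D \<and> (\<forall>E\<in>\<E>. \<exists>E'\<in>\<E>. \<forall>(s, t)\<in>E'. (\<phi> s, \<phi> t) \<in> E)"

lemma index_map_eventually: "index_map \<phi> \<Longrightarrow> eventually P D \<Longrightarrow> \<forall>\<^sub>F s in D. P (\<phi> s)"
  by (simp add: index_map_def filterlim_iff)

lemma index_map_admissible:
  assumes "index_map \<phi>" "admissible f"
  shows "admissible (\<lambda>s. f (\<phi> s))"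
proof -
  obtain E E' where "E' \<in> \<E>" "f respects E" "\<forall>(s, t)\<in>E'. (\<phi> s, \<phi> t) \<in> E"
    using assms unfolding index_map_def admissible_def by metis
  then show ?thesis unfolding admissible_def congruent_def by blast
qed

lemma index_map_maps: "index_map \<phi> \<Longrightarrow> f \<in> maps \<Longrightarrow> (\<lambda>s. f (\<phi> s)) \<in> maps"
  by (auto simp: maps_def index_map_admissible)

lemma index_map_eventually_iff:
  assumes "index_map \<phi>" "admissible P"
  shows "(\<forall>\<^sub>F s in D. P (\<phi> s)) \<longleftrightarrow> eventually P D"
  using index_map_eventually[OF assms(1), of P] index_map_eventually[OF assms(1), of "\<lambda>s. \<not> P s"]
    eventually_not_iff[OF assms(2)] eventually_not_iff[OF index_map_admissible[OF assms]] by blast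

definition induced :: "('s \<Rightarrow> 's) \<Rightarrow> 'm + ('s \<Rightarrow> 'm) \<Rightarrow> 'm + ('s \<Rightarrow> 'm)" where
  "induced \<phi> = (\<lambda>x\<in>universe limit_power. germ (\<lambda>s. germ_rep x (\<phi> s)))"

lemma induced_germ:
  assumes "index_map \<phi>" "f \<in> maps"
  shows "induced \<phi> (germ f) = germ (\<lambda>s. f (\<phi> s))"
  using germ_cong[OF index_map_eventually[OF assms(1) eventually_germ_rep_eq[OF assms(2)]]] assms(2)
  by (simp add: induced_def)

lemma induced_Inl: "index_map \<phi> \<Longrightarrow> m \<in> universe M \<Longrightarrow> induced \<phi> (Inl m) = Inl m"
  using induced_germ[of \<phi> "\<lambda>_. m"] by (simp add: germ_const)

lemma induced_closed: "index_map \<phi> \<Longrightarrow> x \<in> universe limit_power \<Longrightarrow> induced \<phi> x \<in> universe limit_power"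
  by (auto simp: induced_germ index_map_maps)

lemma induced_compose:
  assumes "index_map \<phi>" "index_map \<psi>" "index_map (\<lambda>s. \<psi> (\<phi> s))"
  shows "induced (\<lambda>s. \<psi> (\<phi> s)) = compose (universe limit_power) (induced \<phi>) (induced \<psi>)"
proof
  fix x show "induced (\<lambda>s. \<psi> (\<phi> s)) x = compose (universe limit_power) (induced \<phi>) (induced \<psi>) x"
  proof (cases "x \<in> universe limit_power")
    case True
    then show ?thesis using assms by (auto simp: compose_eq induced_germ index_map_maps)
  qed (simp add: induced_def compose_def)
qed

lemma induced_inverse:
  assumes \<phi>: "index_map \<phi>" and \<psi>: "index_map \<psi>"
    and inv: "\<And>E s. E \<in> \<E> \<Longrightarrow> (\<psi> (\<phi> s), s) \<in> E" and x: "x \<in> universe limit_power"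
  shows "induced \<phi> (induced \<psi> x) = x"
proof -
  obtain f where f: "f \<in> maps" "x = germ f" using x by auto
  then have "f (\<psi> (\<phi> s)) = f s" for s
    using inv maps_admissible unfolding admissible_def by (metis congruentD)
  with f show ?thesis by (simp add: induced_germ \<phi> \<psi> index_map_maps)
qed

lemma induced_preserves_functions:
  assumes \<phi>: "index_map \<phi>" and f: "f \<in> fun_syms L"
    and xs: "xs \<in> tuples (universe limit_power) (fun_arity L f)"
  shows "induced \<phi> (fun_int limit_power f xs) = fun_int limit_power f (map (induced \<phi>) xs)"
proof -
  have xs': "germ_rep x \<in> maps" "induced \<phi> x = germ (\<lambda>s. germ_rep x (\<phi> s))" if "x \<in> set xs" for x
    using xs that by (auto simp: tuples_def induced_def germ_rep_maps subset_iff)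
  have "induced \<phi> (fun_int limit_power f xs) =
      germ (\<lambda>s. fun_int M f (map (\<lambda>x. germ_rep x (\<phi> s)) xs))"
    using f xs xs'(1) by (simp add: tuples_def induced_germ[OF \<phi> maps_fun_int])
  also have "\<dots> = fun_int limit_power f (map (\<lambda>x. germ (\<lambda>s. germ_rep x (\<phi> s))) xs)"
    by (rule fun_int_limit_power[symmetric]) (simp add: xs' index_map_maps \<phi>)
  also have "map (\<lambda>x. germ (\<lambda>s. germ_rep x (\<phi> s))) xs = map (induced \<phi>) xs" using xs'(2) by simp
  finally show ?thesis .
qed

lemma induced_preserves_relations:
  assumes \<phi>: "index_map \<phi>" and xs: "set xs \<subseteq> universe limit_power"
  shows "rel_int limit_power r xs \<longleftrightarrow> rel_int limit_power r (map (induced \<phi>) xs)"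
proof -
  have xs': "germ_rep x \<in> maps" "induced \<phi> x = germ (\<lambda>s. germ_rep x (\<phi> s))" if "x \<in> set xs" for x
    using xs that by (auto simp: induced_def germ_rep_maps)
  have "admissible (\<lambda>s. rel_int M r (map (\<lambda>x. germ_rep x s) xs))"
    by (rule admissible_determined[of "set xs" germ_rep])
      (auto simp: xs' maps_admissible cong: map_cong)
  from index_map_eventually_iff[OF \<phi> this]
  have "rel_int limit_power r xs \<longleftrightarrow> (\<forall>\<^sub>F s in D. rel_int M r (map (\<lambda>x. germ_rep x (\<phi> s)) xs))"
    by simp
  also have "\<dots> \<longleftrightarrow> rel_int limit_power r (map (\<lambda>x. germ (\<lambda>s. germ_rep x (\<phi> s))) xs)"
    by (rule rel_int_limit_power[symmetric]) (simp add: xs' index_map_maps \<phi>)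
  also have "map (\<lambda>x. germ (\<lambda>s. germ_rep x (\<phi> s))) xs = map (induced \<phi>) xs" using xs'(2) by simp
  finally show ?thesis .
qed

lemma induced_automorphism:
  assumes \<phi>: "index_map \<phi>" and \<psi>: "index_map \<psi>"
    and inv: "\<And>E s. E \<in> \<E> \<Longrightarrow> (\<psi> (\<phi> s), s) \<in> E" "\<And>E s. E \<in> \<E> \<Longrightarrow> (\<phi> (\<psi> s), s) \<in> E"
  shows "induced \<phi> \<in> automorphisms L limit_power"
proof -
  have "bij_betw (induced \<phi>) (universe limit_power) (universe limit_power)"
    using induced_inverse[OF \<phi> \<psi> inv(1)] induced_inverse[OF \<psi> \<phi> inv(2)]
      induced_closed[OF \<phi>] induced_closed[OF \<psi>]
    by (intro bij_betw_byWitness[of _ "induced \<psi>"]) blast+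
  then have "induced \<phi> \<in> Bij (universe limit_power)" by (simp add: Bij_def induced_def)
  then show ?thesis
    using induced_preserves_functions[OF \<phi>] induced_preserves_relations[OF \<phi>]
    unfolding automorphisms_def tuples_def by blast
qed

end


section \<open>Iterating an ultrafilter along a linear order\<close>

definition order_filter :: "'n filter \<Rightarrow> 'i set \<Rightarrow> 'i rel \<Rightarrow> ('i \<Rightarrow> 'n) filter" where
  "order_filter U I r = (INF xs\<in>increasing_lists I r. iterated_filter U xs)"

locale iterated_ultrafilter =
  fixes I :: "'i set"
    and less :: "'i rel"
    and U :: "'n filter"
  assumes linear: "strict_linear_order_on I less"
    and ultra: "ultrafilter U"
begin

lemma irrefl_less: "irrefl less" and trans_less: "trans less"
  using linear by (auto simp: strict_linear_order_on_def)

lemma U_neq_bot: "U \<noteq> bot"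
  using ultra by (simp add: ultrafilter_def)

lemma iterated_filter_antimono:
  assumes "xs \<in> increasing_lists I less" "zs \<in> increasing_lists I less" "set xs \<subseteq> set zs"
  shows "iterated_filter U zs \<le> iterated_filter U xs"
proof -
  have "iterated_filter U zs \<le> iterated_filter U (filter (\<lambda>i. i \<in> set xs) zs)"
    by (rule iterated_filter_le_filter[OF increasing_list_distinct[OF irrefl_less assms(2)]])
  also have "filter (\<lambda>i. i \<in> set xs) zs = xs"
    by (rule increasing_list_eq_filter[OF irrefl_less trans_less assms, symmetric])
  finally show ?thesis .
qed

abbreviation D :: "('i \<Rightarrow> 'n) filter" where
  "D \<equiv> order_filter U I less"

lemma eventually_order_filter:
  "eventually P D \<longleftrightarrow> (\<exists>xs\<in>increasing_lists I less. eventually P (iterated_filter U xs))"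
  unfolding order_filter_def
proof (rule eventually_INF_base)
  fix xs ys assume xs: "xs \<in> increasing_lists I less" and ys: "ys \<in> increasing_lists I less"
  obtain zs where "zs \<in> increasing_lists I less" "set zs = set xs \<union> set ys"
    by (rule increasing_list_exists[OF linear, of "set xs \<union> set ys"])
      (use xs ys in \<open>auto dest: increasing_lists_subset\<close>)
  with xs ys show "\<exists>zs\<in>increasing_lists I less.
      iterated_filter U zs \<le> inf (iterated_filter U xs) (iterated_filter U ys)"
    by (auto intro!: bexI[of _ zs] iterated_filter_antimono)
qed (auto intro: increasing_lists_Nil)

lemma eventually_order_filterI:
  "xs \<in> increasing_lists I less \<Longrightarrow> eventually P (iterated_filter U xs) \<Longrightarrow> eventually P D"
  unfolding eventually_order_filter by blast

lemma eventually_order_filter_finite: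
  assumes "eventually P D" "finite F" "F \<subseteq> I"
  obtains zs where "zs \<in> increasing_lists I less" "F \<subseteq> set zs" "eventually P (iterated_filter U zs)"
proof -
  obtain xs where xs: "xs \<in> increasing_lists I less" "eventually P (iterated_filter U xs)"
    using assms(1) unfolding eventually_order_filter by blast
  obtain zs where zs: "zs \<in> increasing_lists I less" "set zs = F \<union> set xs"
    by (rule increasing_list_exists[OF linear, of "F \<union> set xs"])
      (use assms xs(1) in \<open>auto dest: increasing_lists_subset\<close>)
  have "eventually P (iterated_filter U zs)"
    using filter_leD[OF iterated_filter_antimono[OF xs(1) zs(1)] xs(2)] zs(2) by simp
  with zs show thesis by (auto intro: that)
qed

lemma order_filter_neq_bot: "D \<noteq> bot"
  using iterated_filter_neq_bot[OF U_neq_bot]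
  by (auto simp: trivial_limit_def eventually_order_filter)

lemma order_filter_decides:
  assumes "E \<in> finite_agreements I" "P respects E"
  shows "eventually P D \<or> (\<forall>\<^sub>F s in D. \<not> P s)"
proof -
  obtain F where F: "finite F" "F \<subseteq> I" "depends_on F P"
    using assms by (auto simp: finite_agreements_def)
  obtain xs where xs: "xs \<in> increasing_lists I less" "set xs = F"
    using increasing_list_exists[OF linear F(1,2)] .
  then show ?thesis
    using iterated_filter_decides[OF ultra, of xs P] F(3) eventually_order_filterI[OF xs(1)]
    by blast
qed

lemma filterlim_order_automorphism:
  assumes \<alpha>: "\<alpha> \<in> order_automorphisms I less"
  shows "filterlim (\<lambda>s. compose I s \<alpha>) D D"
  unfolding filterlim_iff
proof (intro allI impI)
  fix P assume "eventually P D"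
  then obtain xs where xs: "xs \<in> increasing_lists I less" "eventually P (iterated_filter U xs)"
    unfolding eventually_order_filter by blast
  have "\<forall>\<^sub>F s in iterated_filter U (map \<alpha> xs). P (compose I s \<alpha>)"
    using filterlim_iterated_filter_map[OF order_automorphismD(1)[OF \<alpha>]
        increasing_lists_subset[OF xs(1)]] xs(2)
    unfolding filterlim_iff by blast
  then show "\<forall>\<^sub>F s in D. P (compose I s \<alpha>)"
    by (rule eventually_order_filterI[OF order_automorphism_map_increasing[OF \<alpha> xs(1)]])
qed

lemma eventually_coordinate_neq:
  assumes "U \<le> cofinite" "i \<in> I"
  shows "\<forall>\<^sub>F s in D. s i \<noteq> k"
proof (rule eventually_order_filterI)
  show "\<forall>\<^sub>F s in iterated_filter U [i]. s i \<noteq> k" using eventually_neq_cofinite[OF assms(1)] by simp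
qed (use assms(2) in simp)

lemma eventually_coordinates_neq:
  assumes "U \<le> cofinite" "i \<in> I" "j \<in> I" "i \<noteq> j"
  shows "\<forall>\<^sub>F s in D. s i \<noteq> s j"
proof -
  have "\<forall>\<^sub>F s in D. s i \<noteq> s j" if "(i, j) \<in> less" "i \<in> I" "j \<in> I" "i \<noteq> j" for i j
  proof (rule eventually_order_filterI)
    show "\<forall>\<^sub>F s in iterated_filter U [i, j]. s i \<noteq> s j"
      using eventually_neq_cofinite[OF assms(1)] that(4) by (simp add: eq_commute)
  qed (use that in simp)
  from this[of i j] this[of j i] show ?thesis
    using linear assms by (auto simp: strict_linear_order_on_def total_on_def eq_commute)
qed

definition supports :: "'i set \<Rightarrow> (('i \<Rightarrow> 'n) \<Rightarrow> 'b) \<Rightarrow> bool" where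
  "supports F f \<longleftrightarrow> finite F \<and> F \<subseteq> I \<and> (\<exists>g. depends_on F g \<and> (\<forall>\<^sub>F s in D. g s = f s))"

lemma supports_Int:
  assumes F: "supports F f" and G: "supports G f"
  shows "supports (F \<inter> G) f"
proof -
  obtain g where g: "depends_on F g" "\<forall>\<^sub>F s in D. g s = f s" using F by (auto simp: supports_def)
  obtain h where h: "depends_on G h" "\<forall>\<^sub>F s in D. h s = f s" using G by (auto simp: supports_def)
  have "\<forall>\<^sub>F s in D. g s = h s" using g(2) h(2) by (auto elim: eventually_elim2)
  then obtain zs where zs: "zs \<in> increasing_lists I less" "F \<union> G \<subseteq> set zs"
    "\<forall>\<^sub>F s in iterated_filter U zs. g s = h s"
    by (rule eventually_order_filter_finite[of _ "F \<union> G"]) (use F G in \<open>auto simp: supports_def\<close>)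
  obtain k where k: "depends_on (F \<inter> G) k" "\<forall>\<^sub>F s in iterated_filter U zs. k s = g s"
    using iterated_filter_common_support[OF U_neq_bot zs(2) g(1) h(1) zs(3)] by blast
  have "\<forall>\<^sub>F s in D. k s = f s"
    using eventually_order_filterI[OF zs(1) k(2)] g(2) by eventually_elim simp
  then show ?thesis using k(1) F by (auto simp: supports_def)
qed

lemma least_support_exists:
  assumes "supports G f"
  obtains F where "supports F f" "\<And>F'. supports F' f \<Longrightarrow> F \<subseteq> F'"
proof -
  obtain F where F: "supports F f" and min: "\<And>F'. supports F' f \<Longrightarrow> card F \<le> card F'"
    using ex_has_least_nat[of "\<lambda>F. supports F f" G card] assms by blast
  have "F \<subseteq> F'" if "supports F' f" for F'
  proof -
    have "F \<inter> F' = F"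
      using F min[OF supports_Int[OF F that]] by (intro card_seteq) (auto simp: supports_def)
    then show ?thesis by blast
  qed
  with F show thesis by (rule that)
qed

lemma supports_compose:
  assumes \<alpha>: "\<alpha> \<in> order_automorphisms I less" and F: "supports F f"
  shows "supports (\<alpha> ` F) (\<lambda>s. f (compose I s \<alpha>))"
proof -
  obtain g where g: "depends_on F g" "\<forall>\<^sub>F s in D. g s = f s" and FI: "finite F" "F \<subseteq> I"
    using F by (auto simp: supports_def)
  have "depends_on (\<alpha> ` F) (\<lambda>s. g (compose I s \<alpha>))"
  proof (rule depends_onI)
    fix s t :: "'i \<Rightarrow> 'n" assume "\<And>i. i \<in> \<alpha> ` F \<Longrightarrow> s i = t i"
    then show "g (compose I s \<alpha>) = g (compose I t \<alpha>)"
      using FI(2) by (intro depends_onD[OF g(1)]) (auto simp: compose_eq)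
  qed
  moreover have "\<forall>\<^sub>F s in D. g (compose I s \<alpha>) = f (compose I s \<alpha>)"
    using filterlim_order_automorphism[OF \<alpha>] g(2)
    unfolding filterlim_iff by blast
  moreover have "\<alpha> ` F \<subseteq> I" using FI(2) order_automorphismD(2)[OF \<alpha>] by auto
  ultimately show ?thesis using FI(1) by (auto simp: supports_def)
qed

lemma supports_cong:
  assumes "supports F f" "\<forall>\<^sub>F s in D. f s = g s"
  shows "supports F g"
proof -
  obtain h where h: "depends_on F h" "\<forall>\<^sub>F s in D. h s = f s"
    using assms(1) by (auto simp: supports_def)
  have "\<forall>\<^sub>F s in D. h s = g s" using h(2) assms(2) by eventually_elim simp
  with h(1) assms(1) show ?thesis by (auto simp: supports_def)
qed

lemma supports_empty:
  assumes "supports {} f"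
  obtains c where "\<forall>\<^sub>F s in D. f s = c"
proof -
  obtain g where g: "depends_on {} g" "\<forall>\<^sub>F s in D. g s = f s"
    using assms by (auto simp: supports_def)
  have "f s = g undefined" if "g s = f s" for s
    using that depends_onD[OF g(1), of s undefined] by simp
  then show thesis by (rule that[OF eventually_mono[OF g(2)]])
qed

lemma order_automorphism_fixes_finite_invariant:
  assumes \<alpha>: "\<alpha> \<in> order_automorphisms I less" and F: "finite F" "F \<subseteq> I" "\<alpha> ` F = F" and i: "i \<in> F"
  shows "\<alpha> i = i"
proof -
  obtain xs where xs: "xs \<in> increasing_lists I less" "set xs = F"
    using increasing_list_exists[OF linear F(1,2)] .
  have "map \<alpha> xs = xs"
    by (rule increasing_list_unique[OF irrefl_less trans_less
          order_automorphism_map_increasing[OF \<alpha> xs(1)] xs(1)])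
      (simp add: xs(2) F(3))
  then show ?thesis using i xs(2) by (metis map_eq_conv map_ident)
qed

lemma fixed_by_fixed_point_free_imp_const:
  assumes \<alpha>: "\<alpha> \<in> order_automorphisms I less" and fpf: "fixed_point_free I \<alpha>"
    and "supports G f" and fixed: "\<forall>\<^sub>F s in D. f (compose I s \<alpha>) = f s"
  obtains c where "\<forall>\<^sub>F s in D. f s = c"
proof -
  obtain F where F: "supports F f" and least: "\<And>F'. supports F' f \<Longrightarrow> F \<subseteq> F'"
    using least_support_exists[OF assms(3)] by blast
  then have FI: "finite F" "F \<subseteq> I" by (auto simp: supports_def)
  have "F \<subseteq> \<alpha> ` F" by (rule least[OF supports_cong[OF supports_compose[OF \<alpha> F] fixed]])
  moreover have "card (\<alpha> ` F) \<le> card F" using FI(1) by (rule card_image_le)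
  ultimately have "\<alpha> ` F = F" using FI(1) by (metis card_seteq finite_imageI)
  then have "F = {}"
    using order_automorphism_fixes_finite_invariant[OF \<alpha> FI] fpf FI(2)
    by (auto simp: fixed_point_free_def)
  then show thesis using F that by (metis supports_empty)
qed

end


section \<open>The iterated ultrapower\<close>

locale iterated_ultrapower = iterated_ultrafilter I less U
  for L :: "('f, 'r) language" and M :: "('f, 'r, 'm) fo_struct"
    and I :: "'i set" and less :: "'i rel" and U :: "'n filter" +
  assumes struct: "is_struct L M"
begin

sublocale limit_ultrapower L M "order_filter U I less" "finite_agreements I"
proof
  show "finite_agreements I \<noteq> {}" by (auto simp: finite_agreements_def)
qed (fact struct finite_agreements_directed order_filter_neq_bot order_filter_decides)+

lemma admissible_iff_finite_support:
  "admissible f \<longleftrightarrow> (\<exists>F. finite F \<and> F \<subseteq> I \<and> depends_on F f)"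
  unfolding admissible_def unfolding finite_agreements_def by blast

lemma maps_support:
  assumes "f \<in> maps"
  obtains F where "supports F f"
proof -
  obtain F where "finite F" "F \<subseteq> I" "depends_on F f"
    using maps_admissible[OF assms] unfolding admissible_iff_finite_support by blast
  then have "supports F f" unfolding supports_def by (auto intro!: exI[of _ f])
  then show thesis by (rule that)
qed

lemma maps_coordinate:
  assumes "range \<iota> \<subseteq> universe M" "i \<in> I"
  shows "(\<lambda>s. \<iota> (s i)) \<in> maps"
proof -
  have "depends_on {i} (\<lambda>s. \<iota> (s i))" by (rule depends_onI) simp
  then have "admissible (\<lambda>s. \<iota> (s i))"
    using assms(2) by (auto simp: admissible_iff_finite_support intro!: exI[of _ "{i}"])
  then show ?thesis using assms(1) by (auto simp: maps_def)
qed

lemma proper_elem_extension_limit_power: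
  fixes \<iota> :: "'n \<Rightarrow> 'm"
  assumes \<iota>: "inj \<iota>" "range \<iota> \<subseteq> universe M" and "U \<le> cofinite" "I \<noteq> {}"
  shows "proper_elem_extension L (struct_copy Inl M) limit_power"
proof -
  obtain i where i: "i \<in> I" using assms(4) by blast
  have "germ (\<lambda>s. \<iota> (s i)) \<notin> Inl ` universe M"
  proof
    assume "germ (\<lambda>s. \<iota> (s i)) \<in> Inl ` universe M"
    then obtain m where m: "\<forall>\<^sub>F s in D. \<iota> (s i) = m" using germ_in_Inl by blast
    obtain k where k: "\<iota> k = m" using eventually_happens'[OF order_filter_neq_bot m] by blast
    have "\<forall>\<^sub>F s in D. False"
      using m eventually_coordinate_neq[OF assms(3) i, of k]
      by eventually_elim (use \<iota>(1) k in \<open>auto dest: injD\<close>)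
    then show False using order_filter_neq_bot by simp
  qed
  moreover have "germ (\<lambda>s. \<iota> (s i)) \<in> universe limit_power" using maps_coordinate[OF \<iota>(2) i] by simp
  ultimately have "universe (struct_copy Inl M) \<noteq> universe limit_power"
    unfolding struct_copy_simps by metis
  then show ?thesis using elem_extension_limit_power by (simp add: proper_elem_extension_def)
qed

definition hat :: "('i \<Rightarrow> 'i) \<Rightarrow> 'm + (('i \<Rightarrow> 'n) \<Rightarrow> 'm) \<Rightarrow> 'm + (('i \<Rightarrow> 'n) \<Rightarrow> 'm)" where
  "hat \<alpha> = induced (\<lambda>s. compose I s \<alpha>)"

lemma index_map_compose:
  assumes \<alpha>: "\<alpha> \<in> order_automorphisms I less"
  shows "index_map (\<lambda>s. compose I s \<alpha>)"
  unfolding index_map_def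
proof (intro conjI ballI)
  fix E :: "('i \<Rightarrow> 'n) rel" assume "E \<in> finite_agreements I"
  then obtain F where F: "finite F" "F \<subseteq> I" "E = agree_on F" by (auto simp: finite_agreements_def)
  then have "agree_on (\<alpha> ` F) \<in> finite_agreements I"
    using order_automorphismD(2)[OF \<alpha>] by (auto simp: finite_agreements_def)
  moreover have "\<forall>(s, t)\<in>agree_on (\<alpha> ` F). (compose I s \<alpha>, compose I t \<alpha>) \<in> E"
    using F(2,3) by (auto simp: compose_eq)
  ultimately show "\<exists>E'\<in>finite_agreements I. \<forall>(s, t)\<in>E'. (compose I s \<alpha>, compose I t \<alpha>) \<in> E" by blast
qed (rule filterlim_order_automorphism[OF \<alpha>])

lemma compose_compose:
  assumes "\<beta> \<in> order_automorphisms I less"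
  shows "compose I (compose I s \<alpha>) \<beta> = compose I s (compose I \<alpha> \<beta>)"
  by (rule compose_assoc[symmetric]) (simp add: order_automorphismD(2)[OF assms])

lemma hat_automorphism:
  assumes \<alpha>: "\<alpha> \<in> order_automorphisms I less"
  shows "hat \<alpha> \<in> automorphisms L limit_power"
proof -
  obtain \<beta> where \<beta>: "\<beta> \<in> order_automorphisms I less"
    "compose I \<alpha> \<beta> = (\<lambda>i\<in>I. i)" "compose I \<beta> \<alpha> = (\<lambda>i\<in>I. i)"
    using order_automorphism_inverse[OF \<alpha>] .
  have "(compose I s (\<lambda>i\<in>I. i), s) \<in> E" if "E \<in> finite_agreements I" for E and s :: "'i \<Rightarrow> 'n"
    using that by (auto simp: finite_agreements_def compose_eq subset_iff)
  then show ?thesis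
    unfolding hat_def using \<alpha> \<beta>
    by (intro induced_automorphism[of _ "\<lambda>s. compose I s \<beta>"])
      (simp_all add: index_map_compose compose_compose)
qed

lemma hat_hom: "hat \<in> hom (Aut_order I less) (Aut L limit_power)"
proof (rule homI)
  fix \<alpha> \<beta> assume "\<alpha> \<in> carrier (Aut_order I less)" "\<beta> \<in> carrier (Aut_order I less)"
  then have \<alpha>: "\<alpha> \<in> order_automorphisms I less" and \<beta>: "\<beta> \<in> order_automorphisms I less"
    and mult: "\<alpha> \<otimes>\<^bsub>Aut_order I less\<^esub> \<beta> = compose I \<alpha> \<beta>"
    by (simp_all add: Aut_order_simps)
  have "compose I \<alpha> \<beta> \<in> order_automorphisms I less"
    using monoid.m_closed[OF group.is_monoid[OF group_Aut_order[of I less]], of \<alpha> \<beta>] \<alpha> \<beta>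
    by (simp add: Aut_order_simps)
  then have "hat (compose I \<alpha> \<beta>) = compose (universe limit_power) (hat \<alpha>) (hat \<beta>)"
    using induced_compose[of "\<lambda>s. compose I s \<alpha>" "\<lambda>s. compose I s \<beta>"]
    by (simp add: hat_def index_map_compose \<alpha> \<beta> compose_compose)
  moreover have "hat \<alpha> \<in> Bij (universe limit_power)" "hat \<beta> \<in> Bij (universe limit_power)"
    using hat_automorphism \<alpha> \<beta> unfolding automorphisms_def by blast+
  ultimately show "hat (\<alpha> \<otimes>\<^bsub>Aut_order I less\<^esub> \<beta>) = hat \<alpha> \<otimes>\<^bsub>Aut L limit_power\<^esub> hat \<beta>"
    by (simp add: mult Aut_def BijGroup_def)
qed (simp add: Aut_order_simps Aut_def hat_automorphism)

lemma hat_inj: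
  fixes \<iota> :: "'n \<Rightarrow> 'm"
  assumes \<iota>: "inj \<iota>" "range \<iota> \<subseteq> universe M" and "U \<le> cofinite"
  shows "inj_on hat (order_automorphisms I less)"
proof (rule inj_onI)
  fix \<alpha> \<beta> assume \<alpha>: "\<alpha> \<in> order_automorphisms I less" and \<beta>: "\<beta> \<in> order_automorphisms I less"
    and eq: "hat \<alpha> = hat \<beta>"
  show "\<alpha> = \<beta>"
  proof (rule extensionalityI[OF order_automorphismD(3)[OF \<alpha>] order_automorphismD(3)[OF \<beta>]],
      rule ccontr)
    fix i assume i: "i \<in> I" and neq: "\<alpha> i \<noteq> \<beta> i"
    let ?f = "\<lambda>s. \<iota> (s i)"
    have f: "?f \<in> maps" using \<iota>(2) i by (rule maps_coordinate)
    have "germ (\<lambda>s. ?f (compose I s \<alpha>)) = germ (\<lambda>s. ?f (compose I s \<beta>))"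
      using fun_cong[OF eq, of "germ ?f"] f \<alpha> \<beta>
      by (simp add: hat_def induced_germ index_map_compose)
    then have "\<forall>\<^sub>F s in D. ?f (compose I s \<alpha>) = ?f (compose I s \<beta>)"
      using f \<alpha> \<beta> by (subst (asm) germ_eq_iff) (auto intro: index_map_maps index_map_compose)
    then have "\<forall>\<^sub>F s in D. s (\<alpha> i) = s (\<beta> i)"
      by (rule eventually_mono) (simp add: compose_eq i inj_eq[OF \<iota>(1)])
    moreover have "\<forall>\<^sub>F s in D. s (\<alpha> i) \<noteq> s (\<beta> i)"
      using assms(3) order_automorphismD(2)[OF \<alpha> i] order_automorphismD(2)[OF \<beta> i] neq
      by (rule eventually_coordinates_neq)
    ultimately have "\<forall>\<^sub>F s in D. False" by eventually_elim simp
    then show False using order_filter_neq_bot by simp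
  qed
qed

lemma hat_fixes: "\<alpha> \<in> order_automorphisms I less \<Longrightarrow> m \<in> universe M \<Longrightarrow> hat \<alpha> (Inl m) = Inl m"
  by (simp add: hat_def induced_Inl index_map_compose)

lemma hat_moves:
  assumes \<alpha>: "\<alpha> \<in> order_automorphisms I less" and fpf: "fixed_point_free I \<alpha>"
    and x: "x \<in> universe limit_power - Inl ` universe M"
  shows "hat \<alpha> x \<noteq> x"
proof
  assume fixed: "hat \<alpha> x = x"
  obtain f where f: "f \<in> maps" "x = germ f" using x by auto
  have "\<forall>\<^sub>F s in D. f (compose I s \<alpha>) = f s"
    using fixed f germ_eq_iff[OF index_map_maps[OF index_map_compose[OF \<alpha>] f(1)] f(1)]
    by (simp add: hat_def induced_germ index_map_compose \<alpha>)
  then obtain c where c: "\<forall>\<^sub>F s in D. f s = c"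
    using fixed_by_fixed_point_free_imp_const[OF \<alpha> fpf] maps_support[OF f(1)] by metis
  then have "c \<in> universe M"
    using eventually_happens'[OF order_filter_neq_bot c] maps_closed[OF f(1)] by auto
  then have "x \<in> Inl ` universe M" using germ_cong[OF c] f(2) by (simp add: germ_const)
  with x show False by blast
qed

end

theorem theorem2p4:
  fixes L :: "('f, 'r) language"
    and M :: "('f, 'r, 'm) fo_struct"
    and I :: "'i set"
    and less :: "'i rel"
  assumes "is_struct L M"
    and "infinite (universe M)"
    and "strict_linear_order_on I less"
    and "I \<noteq> {}"
  shows "\<exists>(N :: ('f, 'r, ('i, 'm) ambient) fo_struct) hat.
           proper_elem_extension L (struct_copy Inl M) N \<and>
           hat \<in> mon (Aut_order I less) (Aut L N) \<and>
           (\<forall>\<alpha>\<in>carrier (Aut_order I less). fixed_point_free I \<alpha> \<longrightarrow>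
              (\<forall>x\<in>universe N - universe (struct_copy Inl M). hat \<alpha> x \<noteq> x) \<and>
              (\<forall>x\<in>universe (struct_copy Inl M). hat \<alpha> x = x))"
proof -
  obtain U :: "nat filter" where ultra: "ultrafilter U" and free: "U \<le> cofinite"
    using ultrafilter_exists[of "cofinite :: nat filter"] by auto
  interpret iterated_ultrapower L M I less U
    using ultra assms(1,3) by unfold_locales
  obtain \<iota> :: "nat \<Rightarrow> 'm" where \<iota>: "inj \<iota>" "range \<iota> \<subseteq> universe M"
    using infinite_countable_subset[OF assms(2)] by blast
  have "proper_elem_extension L (struct_copy Inl M) limit_power"
    by (rule proper_elem_extension_limit_power[OF \<iota> free assms(4)])
  moreover have "hat \<in> mon (Aut_order I less) (Aut L limit_power)"
    using hat_hom hat_inj[OF \<iota> free] by (simp add: mon_def Aut_order_simps)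
  moreover have "hat \<alpha> x \<noteq> x"
    if "\<alpha> \<in> order_automorphisms I less" "fixed_point_free I \<alpha>"
      "x \<in> universe limit_power - universe (struct_copy Inl M)" for \<alpha> x
    using hat_moves that by simp
  moreover have "hat \<alpha> x = x"
    if "\<alpha> \<in> order_automorphisms I less" "x \<in> universe (struct_copy Inl M)" for \<alpha> x
    using hat_fixes that by auto
  ultimately show ?thesis unfolding Aut_order_simps by blast
qed

end
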